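(* Let $p$ be a prime number with $p \equiv -1 \pmod 3$, and let $a, b, c$ be integers prime to $p$. Then the plane cubic curve $C: aX^3 + bpY^3 + cp^2 Z^3 = 0$ in $\mathbb{P}^2$ has no points rational over $\mathbb{Q}_p^{\mathrm{ab}}$, i.e. $C(\mathbb{Q}_p^{\mathrm{ab}}) = \emptyset$.
   Context: For a field $K$, $K^{\mathrm{ab}}$ denotes the maximal abelian extension of $K$ (inside a fixed algebraic closure). $\mathbb{Q}_p$ is the field of $p$-adic numbers. *)

theory Defs
  imports
    "Berlekamp_Zassenhaus.Finite_Field"
    "HOL-Computational_Algebra.Fraction_Field"
    "HOL-Algebra.Algebraic_Closure_Type"
    "HOL-Library.FuncSet"
begin

section \<open>The field of p-adic numbers\<close>

text \<open>
  The prime p is the cardinality of a type of class \<^class>\<open>prime_card\<close>. The p-adic integers are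
  the inverse limit of the rings of integers modulo \<open>p ^ n\<close>, the residue classes being represented
  by the integers \<open>0, \<dots>, p ^ n - 1\<close>: the condition below also forces \<open>0 \<le> f n < p ^ n\<close>.
\<close>

typedef 'p padic_int =
  "{f :: nat \<Rightarrow> int. \<forall>n. f (Suc n) mod int CARD('p :: prime_card) ^ n = f n}"
  by (rule exI[of _ "\<lambda>_. 0"]) simp

setup_lifting type_definition_padic_int

lemma card_pos: "0 < int CARD('p :: prime_card)"
  using prime_gt_0_nat[OF prime_card[where 'a = 'p]] by simp

lemma mod_Suc_power_mod: "(a mod q ^ Suc n) mod q ^ n = a mod (q :: int) ^ n"
  by (rule mod_mod_cancel) simp

lemma compat_mod:
  assumes "\<forall>n. f (Suc n) mod (q :: int) ^ n = f n"
  shows "f n mod q ^ n = f n"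
  using assms by (metis mod_mod_trivial)

lemma compat_mod_le:
  assumes "\<forall>n. f (Suc n) mod (q :: int) ^ n = f n" and "m \<le> n"
  shows "f n mod q ^ m = f m"
  using assms(2)
proof (induction n rule: dec_induct)
  case base
  show ?case using compat_mod[OF assms(1)] .
next
  case (step n)
  have "f (Suc n) mod q ^ m = (f (Suc n) mod q ^ n) mod q ^ m"
    using step.hyps by (intro mod_mod_cancel[symmetric] le_imp_power_dvd) simp
  then show ?case using step.IH assms(1) by simp
qed

instantiation padic_int :: (prime_card) comm_ring_1
begin

lift_definition zero_padic_int :: "'a padic_int" is "\<lambda>_. 0"
  by simp

lift_definition one_padic_int :: "'a padic_int" is "\<lambda>n. 1 mod int CARD('a) ^ n"
  by (simp only: mod_Suc_power_mod)

lift_definition plus_padic_int :: "'a padic_int \<Rightarrow> 'a padic_int \<Rightarrow> 'a padic_int"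
  is "\<lambda>f g n. (f n + g n) mod int CARD('a) ^ n"
  by (simp only: mod_Suc_power_mod) (metis mod_add_eq)

lift_definition times_padic_int :: "'a padic_int \<Rightarrow> 'a padic_int \<Rightarrow> 'a padic_int"
  is "\<lambda>f g n. (f n * g n) mod int CARD('a) ^ n"
  by (simp only: mod_Suc_power_mod) (metis mod_mult_eq)

lift_definition uminus_padic_int :: "'a padic_int \<Rightarrow> 'a padic_int"
  is "\<lambda>f n. (- f n) mod int CARD('a) ^ n"
  by (simp only: mod_Suc_power_mod) (metis mod_minus_eq)

lift_definition minus_padic_int :: "'a padic_int \<Rightarrow> 'a padic_int \<Rightarrow> 'a padic_int"
  is "\<lambda>f g n. (f n - g n) mod int CARD('a) ^ n"
  by (simp only: mod_Suc_power_mod) (metis mod_diff_eq)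

instance
proof
  fix a b c :: "'a padic_int"
  show "a * b * c = a * (b * c)"
    by transfer (simp add: mod_simps mult.assoc)
  show "a * b = b * a"
    by transfer (simp add: mult.commute)
  show "1 * a = a"
    by transfer (simp add: mod_simps fun_eq_iff compat_mod)
  show "a + b + c = a + (b + c)"
    by transfer (simp add: mod_simps add.assoc)
  show "a + b = b + a"
    by transfer (simp add: add.commute)
  show "0 + a = a"
    by transfer (simp add: fun_eq_iff compat_mod)
  show "- a + a = 0"
    by transfer (simp add: mod_simps)
  show "a - b = a + - b"
    by transfer (simp add: mod_simps)
  show "(a + b) * c = a * c + b * c"
    by transfer (simp add: mod_simps distrib_right)
  show "(0 :: 'a padic_int) \<noteq> 1"
  proof (transfer, rule notI)
    assume "(\<lambda>_. 0) = (\<lambda>n. 1 mod int CARD('a) ^ n)"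
    from fun_cong[OF this, of 1] have "1 mod int CARD('a) = 0" by simp
    then show False
      using prime_gt_1_nat[OF prime_card[where 'a = 'a]] by simp
  qed
qed

end

lemma prime_power_dvd_mult_split:
  fixes a b q :: int
  assumes "prime_elem q" "q ^ (m + n) dvd a * b"
  shows "q ^ m dvd a \<or> q ^ n dvd b"
proof (cases "a = 0 \<or> b = 0")
  case False
  have "m + n \<le> multiplicity q (a * b)"
    using assms False by (intro multiplicity_geI) auto
  also have "\<dots> = multiplicity q a + multiplicity q b"
    using assms(1) False by (intro prime_elem_multiplicity_mult_distrib) auto
  finally have "m \<le> multiplicity q a \<or> n \<le> multiplicity q b"
    by linarith
  then show ?thesis
    using multiplicity_dvd' by blast
qed auto

instance padic_int :: (prime_card) idom
proof
  fix a b :: "'a padic_int"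
  assume "a \<noteq> 0" "b \<noteq> 0"
  then show "a * b \<noteq> 0"
  proof (transfer, intro notI)
    fix f g :: "nat \<Rightarrow> int"
    let ?q = "int CARD('a)"
    assume f: "\<forall>n. f (Suc n) mod ?q ^ n = f n" and g: "\<forall>n. g (Suc n) mod ?q ^ n = g n"
      and "f \<noteq> (\<lambda>_. 0)" "g \<noteq> (\<lambda>_. 0)" and fg: "(\<lambda>n. f n * g n mod ?q ^ n) = (\<lambda>_. 0)"
    then obtain m n where mn: "f m \<noteq> 0" "g n \<noteq> 0" by (meson ext)
    have "?q ^ (m + n) dvd f (m + n) * g (m + n)"
      using fun_cong[OF fg, of "m + n"] by auto
    then have "?q ^ m dvd f (m + n) \<or> ?q ^ n dvd g (m + n)"
      by (intro prime_power_dvd_mult_split prime_imp_prime_elem prime_card_int)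
    then show False
      using mn compat_mod_le[OF f, of m "m + n"] compat_mod_le[OF g, of n "m + n"] by auto
  qed
qed

type_synonym 'p padic = "'p padic_int fract"


section \<open>The maximal abelian extension of a field\<close>

text \<open>
  Algebraic extensions of a field \<open>K\<close>, given by a type \<open>'k\<close>, are taken to be subfields of the
  algebraic closure \<^typ>\<open>'k alg_closure\<close> that contain the image of \<open>K\<close> under \<^const>\<open>to_ac\<close>.
\<close>

definition intermediate_field :: "'k :: field alg_closure set \<Rightarrow> bool" where
  "intermediate_field F \<longleftrightarrow>
     range to_ac \<subseteq> F \<and>
     (\<forall>x\<in>F. \<forall>y\<in>F. x + y \<in> F \<and> x * y \<in> F) \<and>
     (\<forall>x\<in>F. - x \<in> F \<and> inverse x \<in> F)"

definition galois_group :: "'k :: field alg_closure set \<Rightarrow> ('k alg_closure \<Rightarrow> 'k alg_closure) set" where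
  "galois_group F =
     {\<sigma> \<in> extensional F. bij_betw \<sigma> F F \<and>
        (\<forall>x\<in>F. \<forall>y\<in>F. \<sigma> (x + y) = \<sigma> x + \<sigma> y \<and> \<sigma> (x * y) = \<sigma> x * \<sigma> y) \<and>
        (\<forall>k. \<sigma> (to_ac k) = to_ac k)}"

definition galois_extension :: "'k :: field alg_closure set \<Rightarrow> bool" where
  "galois_extension F \<longleftrightarrow>
     intermediate_field F \<and> {x \<in> F. \<forall>\<sigma>\<in>galois_group F. \<sigma> x = x} = range to_ac"

definition abelian_extension :: "'k :: field alg_closure set \<Rightarrow> bool" where
  "abelian_extension F \<longleftrightarrow>
     galois_extension F \<and>
     (\<forall>\<sigma>\<in>galois_group F. \<forall>\<tau>\<in>galois_group F. \<forall>x\<in>F. \<sigma> (\<tau> x) = \<tau> (\<sigma> x))"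

text \<open>
  A compositum of abelian extensions is abelian, so the union of all abelian extensions is the
  largest one.
\<close>

definition max_abelian_extension :: "'k :: field alg_closure set" where
  "max_abelian_extension = \<Union> {F. abelian_extension F}"

lemma intermediate_field_range_to_ac: "intermediate_field (range to_ac)"
  unfolding intermediate_field_def
  by (auto simp flip: to_ac_add to_ac_mult to_ac_minus to_ac_inverse)

lemma abelian_extension_range_to_ac: "abelian_extension (range to_ac)"
  unfolding abelian_extension_def galois_extension_def
  using intermediate_field_range_to_ac by (auto simp: galois_group_def)

lemma range_to_ac_subset: "range to_ac \<subseteq> max_abelian_extension"
  unfolding max_abelian_extension_def using abelian_extension_range_to_ac by blast


section \<open>Points of plane curves\<close>

text \<open>In the following, \<open>F\<close> is meant to be a subfield of the ambient field.\<close>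

definition homogeneous_coords :: "'a :: field set \<Rightarrow> ('a \<times> 'a \<times> 'a) set" where
  "homogeneous_coords F = F \<times> F \<times> F - {(0, 0, 0)}"

definition proportional :: "'a :: field set \<Rightarrow> (('a \<times> 'a \<times> 'a) \<times> ('a \<times> 'a \<times> 'a)) set" where
  "proportional F =
     {((x, y, z), (x', y', z')) | x y z x' y' z'.
        (x, y, z) \<in> homogeneous_coords F \<and> (x', y', z') \<in> homogeneous_coords F \<and>
        (\<exists>t\<in>F - {0}. x' = t * x \<and> y' = t * y \<and> z' = t * z)}"

definition proj_plane :: "'a :: field set \<Rightarrow> ('a \<times> 'a \<times> 'a) set set" where
  "proj_plane F = homogeneous_coords F // proportional F"

text \<open>
  The \<open>F\<close>-rational points of the plane curve \<open>f = 0\<close>, for a homogeneous polynomial function \<open>f\<close>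
  (so that its vanishing does not depend on the choice of homogeneous coordinates).
\<close>

definition curve_points ::
    "'a :: field set \<Rightarrow> ('a \<Rightarrow> 'a \<Rightarrow> 'a \<Rightarrow> 'a) \<Rightarrow> ('a \<times> 'a \<times> 'a) set set" where
  "curve_points F f = {P \<in> proj_plane F. \<forall>(x, y, z)\<in>P. f x y z = 0}"

end

theory Submission
  imports Defs "HOL-Algebra.Exponent" "HOL-Number_Theory.Residues"
begin

text \<open>
  Extend the \<open>p\<close>-adic valuation, with \<open>v p = 1\<close>, to the algebraic closure. It suffices that
  \<open>v x\<close> has denominator prime to \<open>3\<close> for all nonzero \<open>x\<close> in an abelian extension \<open>F\<close>: then the
  valuations of \<open>a x\<^sup>3\<close>, \<open>b p y\<^sup>3\<close>, \<open>c p\<^sup>2 z\<^sup>3\<close> are pairwise distinct, so the three terms cannot cancel.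

  If \<open>v x\<close> has denominator divisible by \<open>3\<close>, some \<open>u \<in> F\<close> has \<open>v u = 1 / 3\<close>. As the Galois group is
  commutative, contains lifts of Frobenius, and \<open>p - 1\<close> is prime to \<open>3\<close>, the element \<open>u\<close> can be
  modified by units so that \<open>\<sigma> u / u\<close> is congruent to \<open>1\<close> for all \<open>\<sigma>\<close>. With \<open>N\<close> the number of
  conjugates of \<open>u\<close> and \<open>p ^ k\<close> the exact power of \<open>p\<close> dividing \<open>N\<close>, the elementary symmetric
  function of degree \<open>p ^ k\<close> of the conjugates lies in the base field and has valuation \<open>p ^ k / 3\<close>,
  which is not an integer.

  The valuation ring is obtained from Zorn's lemma; completeness shows that it is integral over the
  \<open>p\<close>-adic integers, so that it is stable under the Galois group.
\<close>

section \<open>Valuation rings from Zorn's lemma\<close>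

definition is_subring :: "'a::field set \<Rightarrow> bool" where
  "is_subring A \<longleftrightarrow> 1 \<in> A \<and> (\<forall>x\<in>A. \<forall>y\<in>A. x + y \<in> A \<and> x * y \<in> A) \<and> (\<forall>x\<in>A. - x \<in> A)"

lemma is_subringD:
  assumes "is_subring A"
  shows subring_1: "1 \<in> A" and subring_0: "0 \<in> A"
    and subring_add: "x \<in> A \<Longrightarrow> y \<in> A \<Longrightarrow> x + y \<in> A"
    and subring_mult: "x \<in> A \<Longrightarrow> y \<in> A \<Longrightarrow> x * y \<in> A"
    and subring_minus: "x \<in> A \<Longrightarrow> - x \<in> A"
    and subring_diff: "x \<in> A \<Longrightarrow> y \<in> A \<Longrightarrow> x - y \<in> A"
proof -
  show *: "1 \<in> A" "x \<in> A \<Longrightarrow> y \<in> A \<Longrightarrow> x + y \<in> A" "x \<in> A \<Longrightarrow> y \<in> A \<Longrightarrow> x * y \<in> A" "x \<in> A \<Longrightarrow> - x \<in> A" for x y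
    using assms by (auto simp: is_subring_def)
  show "x \<in> A \<Longrightarrow> y \<in> A \<Longrightarrow> x - y \<in> A" for x y
    using *(2)[of x "- y"] *(4)[of y] by simp
  from this[of 1 1] * show "0 \<in> A" by simp
qed

lemma subring_power: "is_subring A \<Longrightarrow> x \<in> A \<Longrightarrow> x ^ n \<in> A"
  by (induction n) (auto intro: is_subringD)

lemma subring_sum: "is_subring A \<Longrightarrow> (\<And>i. i \<in> S \<Longrightarrow> f i \<in> A) \<Longrightarrow> sum f S \<in> A"
  by (induction S rule: infinite_finite_induct) (auto intro: is_subringD)

lemma subring_prod: "is_subring A \<Longrightarrow> (\<And>i. i \<in> S \<Longrightarrow> f i \<in> A) \<Longrightarrow> prod f S \<in> A"
  by (induction S rule: infinite_finite_induct) (auto intro: is_subringD)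

lemma subring_of_nat: "is_subring A \<Longrightarrow> of_nat n \<in> A"
  by (induction n) (auto intro: is_subringD)

lemma subring_of_int: "is_subring A \<Longrightarrow> of_int n \<in> A"
  by (cases n) (auto intro: subring_of_nat subring_minus simp del: of_nat_Suc)

lemma subring_poly: "is_subring A \<Longrightarrow> (\<And>i. coeff f i \<in> A) \<Longrightarrow> x \<in> A \<Longrightarrow> poly f x \<in> A"
  unfolding poly_altdef by (intro subring_sum subring_mult subring_power) auto

section \<open>Adjoining one element to a subring\<close>

definition adjoin :: "'a::field set \<Rightarrow> 'a \<Rightarrow> 'a set" where
  "adjoin A x = {poly f x | f. \<forall>i. coeff f i \<in> A}"

lemma subset_adjoin: "is_subring A \<Longrightarrow> A \<subseteq> adjoin A x"
proof
  fix a assume "is_subring A" "a \<in> A"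
  then have "\<forall>i. coeff [:a:] i \<in> A" "a = poly [:a:] x"
    by (auto simp: coeff_pCons subring_0 split: nat.splits)
  then show "a \<in> adjoin A x" unfolding adjoin_def by blast
qed

lemma mem_adjoin: "is_subring A \<Longrightarrow> x \<in> adjoin A x"
proof -
  assume "is_subring A"
  then have "\<forall>i. coeff [:0, 1:] i \<in> A" "x = poly [:0, 1:] x"
    by (auto simp: coeff_pCons subring_0 subring_1 split: nat.splits)
  then show ?thesis unfolding adjoin_def by blast
qed

lemma is_subring_adjoin:
  assumes A: "is_subring A"
  shows "is_subring (adjoin A x)"
  unfolding is_subring_def
proof (intro conjI ballI)
  show "1 \<in> adjoin A x" using subset_adjoin[OF A] subring_1[OF A] by blast
next
  fix y z assume "y \<in> adjoin A x" "z \<in> adjoin A x"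
  then obtain f g where fg: "y = poly f x" "z = poly g x" "\<And>i. coeff f i \<in> A" "\<And>i. coeff g i \<in> A"
    unfolding adjoin_def by blast
  have "y + z = poly (f + g) x" "\<forall>i. coeff (f + g) i \<in> A"
    using fg A by (auto intro: subring_add)
  then show "y + z \<in> adjoin A x" unfolding adjoin_def by blast
  have "y * z = poly (f * g) x" "\<forall>i. coeff (f * g) i \<in> A"
    using fg A by (auto simp: coeff_mult intro!: subring_sum subring_mult)
  then show "y * z \<in> adjoin A x" unfolding adjoin_def by blast
next
  fix y assume "y \<in> adjoin A x"
  then obtain f where fg: "y = poly f x" "\<And>i. coeff f i \<in> A"
    unfolding adjoin_def by blast
  have "- y = poly (- f) x" "\<forall>i. coeff (- f) i \<in> A"
    using fg A by (auto intro: subring_minus)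
  then show "- y \<in> adjoin A x" unfolding adjoin_def by blast
qed

text \<open>Since \<open>t\<close> is the inverse of \<open>s\<close>, multiplication by
  \<open>s ^ degree f\<close> turns each \<open>t ^ i\<close> that occurs into a power of
  \<open>s\<close>.\<close>

lemma poly_inverse_clear_denominator:
  assumes A: "is_subring A" and f: "\<And>i. coeff f i \<in> A" and s: "s \<in> A" "s * t = 1"
  shows "s ^ Polynomial.degree f * poly f t \<in> A"
proof -
  have "s ^ Polynomial.degree f * (coeff f i * t ^ i) = coeff f i * s ^ (Polynomial.degree f - i)" if "i \<le> Polynomial.degree f" for i
  proof -
    have "s ^ Polynomial.degree f * t ^ i = s ^ (Polynomial.degree f - i) * (s * t) ^ i"
      using that by (simp add: power_mult_distrib mult.assoc[symmetric] power_add[symmetric])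
    then show ?thesis using s(2) by (simp add: algebra_simps)
  qed
  then have "s ^ Polynomial.degree f * poly f t = (\<Sum>i\<le>Polynomial.degree f. coeff f i * s ^ (Polynomial.degree f - i))"
    by (simp only: poly_altdef sum_distrib_left) (intro sum.cong refl, simp)
  also have "\<dots> \<in> A"
    by (intro subring_sum subring_mult subring_power A f s)
  finally show ?thesis .
qed

text \<open>By maximality every strictly larger subring contains \<open>inverse q\<close>. This is
  what forces \<open>A\<close> to be a valuation ring, as shown in
  \<open>mem_or_inverse_mem\<close>.\<close>

locale maximal_subring =
  fixes A :: "'a::field set" and q :: 'a
  assumes A: "is_subring A" and q: "q \<in> A" "inverse q \<notin> A"
    and maximal: "\<And>B. is_subring B \<Longrightarrow> A \<subseteq> B \<Longrightarrow> inverse q \<notin> B \<Longrightarrow> B = A"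
begin

lemma q_nonzero: "q \<noteq> 0"
  using q by auto

lemma q_mult_neq_1: "y \<in> A \<Longrightarrow> q * y \<noteq> 1"
  using q by (metis inverse_unique)

lemma adjoin_obtain:
  assumes "x \<notin> A"
  obtains f where "\<And>i. coeff f i \<in> A" "q * poly f x = 1"
proof -
  have "adjoin A x \<noteq> A" using mem_adjoin[OF A] assms by blast
  then have "inverse q \<in> adjoin A x"
    using maximal[OF is_subring_adjoin[OF A] subset_adjoin[OF A]] by blast
  then obtain f where "\<And>i. coeff f i \<in> A" "inverse q = poly f x"
    unfolding adjoin_def by blast
  with that q_nonzero show ?thesis by (metis right_inverse)
qed

text \<open>Otherwise \<open>inverse q\<close> would be a polynomial in the inverse of
  \<open>s = 1 - q * y\<close>. Clearing denominators gives \<open>q * a = s ^ n\<close>, and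
  \<open>s ^ n\<close> is \<open>1\<close> modulo \<open>q\<close>, so \<open>q\<close> would be
  invertible in \<open>A\<close>.\<close>

lemma inverse_one_minus:
  assumes y: "y \<in> A"
  shows "inverse (1 - q * y) \<in> A"
proof (rule ccontr)
  let ?s = "1 - q * y"
  assume nA: "inverse ?s \<notin> A"
  obtain f where f: "\<And>i. coeff f i \<in> A" "q * poly f (inverse ?s) = 1"
    using adjoin_obtain[OF nA] by blast
  have s: "?s \<in> A" "?s * inverse ?s = 1"
    using y q q_mult_neq_1[OF y] by (auto intro!: is_subringD[OF A])
  define a where "a = ?s ^ Polynomial.degree f * poly f (inverse ?s)"
  have a: "a \<in> A" unfolding a_def by (rule poly_inverse_clear_denominator[OF A f(1) s])
  have "q * a = ?s ^ Polynomial.degree f"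
    using f(2) by (simp add: a_def mult.left_commute)
  moreover have "\<exists>b\<in>A. ?s ^ n = 1 - q * b" for n
  proof (induction n)
    case 0
    show ?case using subring_0[OF A] by auto
  next
    case (Suc n)
    then obtain b where b: "b \<in> A" "?s ^ n = 1 - q * b" by blast
    have "?s ^ Suc n = 1 - q * (y + b - q * y * b)"
      unfolding power_Suc b(2) by (simp add: algebra_simps)
    moreover have "y + b - q * y * b \<in> A"
      by (intro is_subringD[OF A] y b q)
    ultimately show ?case by blast
  qed
  ultimately obtain b where "b \<in> A" "q * a = 1 - q * b" by metis
  then show False
    using q_mult_neq_1[of "a + b"] a subring_add[OF A] by (auto simp: algebra_simps)
qed

text \<open>The constant coefficient of \<open>1 - q * g\<close>, namely
  \<open>1 - q * coeff g 0\<close>, is a unit. Multiplying the relation for \<open>y\<close> by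
  \<open>x ^ n\<close> therefore expresses \<open>x ^ n\<close> as \<open>q\<close> times a
  polynomial in \<open>x\<close> of lower degree, which replaces the leading term of
  \<open>f\<close>.\<close>

lemma reduce_relation:
  assumes xy: "x * y = 1" and f: "\<And>i. coeff f i \<in> A" and g: "\<And>i. coeff g i \<in> A"
    and qf: "q * poly f x = 1" and qg: "q * poly g y = 1" and deg: "Polynomial.degree g \<le> Polynomial.degree f"
  shows "\<exists>f'. (\<forall>i. coeff f' i \<in> A) \<and> q * poly f' x = 1 \<and> Polynomial.degree f' < Polynomial.degree f"
proof -
  define n m e where "n = Polynomial.degree f" and "m = Polynomial.degree g" and "e = inverse (1 - q * coeff g 0)"
  have e: "e \<in> A" unfolding e_def by (rule inverse_one_minus) (rule g)
  have e1: "e * (1 - q * coeff g 0) = 1"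
    using q_mult_neq_1[OF g, of 0] by (simp add: e_def)
  have n: "n > 0"
  proof (rule ccontr)
    assume "\<not> n > 0"
    then obtain c where "f = [:c:]" unfolding n_def by (auto elim: degree_eq_zeroE)
    then show False using qf q_mult_neq_1[OF f, of 0] by simp
  qed
  define h where "h = (\<Sum>j\<in>{1..m}. monom (e * coeff g j) (n - j))"
  have h: "coeff h i \<in> A" for i
    unfolding h_def coeff_sum by (intro subring_sum A) (auto intro!: subring_mult A e g subring_0)
  have degh: "Polynomial.degree h < n"
    unfolding h_def using n by (intro degree_sum_less) (auto intro: le_less_trans[OF degree_monom_le])
  have "poly g y = coeff g 0 + (\<Sum>j\<in>{1..m}. coeff g j * y ^ j)"
    unfolding poly_altdef m_def by (simp add: atMost_atLeast0 sum.atLeast_Suc_atMost)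
  with qg have "1 - q * coeff g 0 = q * (\<Sum>j\<in>{1..m}. coeff g j * y ^ j)"
    by (simp add: algebra_simps)
  then have "x ^ n = x ^ n * (e * (q * (\<Sum>j\<in>{1..m}. coeff g j * y ^ j)))"
    using e1 by simp
  also have "\<dots> = q * (\<Sum>j\<in>{1..m}. (e * coeff g j) * (x ^ n * y ^ j))"
    by (simp add: sum_distrib_left mult_ac)
  also have "(\<Sum>j\<in>{1..m}. (e * coeff g j) * (x ^ n * y ^ j)) = poly h x"
    unfolding h_def poly_sum poly_monom
  proof (intro sum.cong refl)
    fix j assume "j \<in> {1..m}"
    then have "n = n - j + j" using deg by (auto simp: n_def m_def)
    then have "x ^ n * y ^ j = x ^ (n - j) * (x * y) ^ j"
      by (metis mult.assoc power_add power_mult_distrib)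
    then show "e * coeff g j * (x ^ n * y ^ j) = e * coeff g j * x ^ (n - j)"
      using xy by simp
  qed
  finally have xn: "x ^ n = q * poly h x" .
  define f' where "f' = f - monom (coeff f n) n + smult (q * coeff f n) h"
  have "Polynomial.degree (f - monom (coeff f n) n) < n"
    using n by (intro degree_lessI) (auto simp: n_def coeff_eq_0)
  then have "Polynomial.degree f' < n"
    unfolding f'_def using degh
    by (intro degree_add_less) (auto intro: le_less_trans[OF degree_smult_le])
  moreover have "poly f' x = poly f x"
    by (simp add: f'_def poly_monom xn)
  moreover have "coeff f' i \<in> A" for i
    unfolding f'_def by (auto intro!: is_subringD[OF A] f h q)
  ultimately show ?thesis using qf unfolding n_def by metis
qed

text \<open>Descent on the sum of the degrees: the relation of larger degree is reduced, the roles
  of \<open>x\<close> and \<open>y\<close> being symmetric.\<close>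

lemma no_two_relations:
  assumes "x * y = 1" "\<And>i. coeff f i \<in> A" "\<And>i. coeff g i \<in> A"
    "q * poly f x = 1" "q * poly g y = 1"
  shows False
  using assms
proof (induction "Polynomial.degree f + Polynomial.degree g" arbitrary: f g rule: less_induct)
  case less
  show False
  proof (cases "Polynomial.degree g \<le> Polynomial.degree f")
    case True
    from reduce_relation[OF less.prems True] obtain f'
      where "\<And>i. coeff f' i \<in> A" "q * poly f' x = 1" "Polynomial.degree f' < Polynomial.degree f" by blast
    then show False using less.hyps[of f' g] less.prems by simp
  next
    case False
    then have deg: "Polynomial.degree f \<le> Polynomial.degree g" by simp
    have "y * x = 1" using less.prems by (simp add: mult.commute)
    from reduce_relation[OF this less.prems(3,2,5,4) deg] obtain g'
      where "\<And>i. coeff g' i \<in> A" "q * poly g' y = 1" "Polynomial.degree g' < Polynomial.degree g" by blast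
    then show False using less.hyps[of f g'] less.prems by simp
  qed
qed

lemma mem_or_inverse_mem: "x \<in> A \<or> inverse x \<in> A"
proof (rule ccontr)
  assume *: "\<not> (x \<in> A \<or> inverse x \<in> A)"
  then have "x * inverse x = 1" using subring_0[OF A] by (cases "x = 0") auto
  then show False
    using * no_two_relations adjoin_obtain[of x] adjoin_obtain[of "inverse x"] by metis
qed

end

text \<open>Zorn's lemma is applied to the subrings that contain \<open>Z\<close> and miss
  \<open>inverse q\<close>; the union of a nonempty chain of them is again one.\<close>

lemma exists_valuation_ring:
  fixes Z :: "'a::field set"
  assumes Z: "is_subring Z" and q: "q \<in> Z" "inverse q \<notin> Z"
  obtains A where "is_subring A" "Z \<subseteq> A" "inverse q \<notin> A" "\<And>x. x \<in> A \<or> inverse x \<in> A"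
proof -
  define \<A> where "\<A> = {B. is_subring B \<and> Z \<subseteq> B \<and> inverse q \<notin> B}"
  have "\<exists>M\<in>\<A>. (\<forall>B\<in>\<A>. M \<subseteq> B \<longrightarrow> B = M)"
  proof (rule subset_Zorn_nonempty)
    show "\<A> \<noteq> {}" using assms unfolding \<A>_def by blast
    fix \<C> assume ne: "\<C> \<noteq> {}" and ch: "subset.chain \<A> \<C>"
    then have mem: "is_subring B" "Z \<subseteq> B" "inverse q \<notin> B" if "B \<in> \<C>" for B
      using that ch by (auto simp: subset_chain_def \<A>_def)
    have two: "\<exists>B\<in>\<C>. x \<in> B \<and> y \<in> B" if "x \<in> \<Union>\<C>" "y \<in> \<Union>\<C>" for x y
      using that ch unfolding subset_chain_def by blast
    have "is_subring (\<Union>\<C>)"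
      unfolding is_subring_def
    proof (intro conjI ballI)
      show "1 \<in> \<Union>\<C>" using ne mem(1) subring_1 by blast
      fix x assume x: "x \<in> \<Union>\<C>"
      then show "- x \<in> \<Union>\<C>" using mem(1) subring_minus by blast
      fix y assume "y \<in> \<Union>\<C>"
      then obtain B where "B \<in> \<C>" "x \<in> B" "y \<in> B" using two[OF x] by blast
      then show "x + y \<in> \<Union>\<C>" "x * y \<in> \<Union>\<C>"
        using mem(1)[of B] subring_add[of B x y] subring_mult[of B x y] by auto
    qed
    then show "\<Union>\<C> \<in> \<A>" unfolding \<A>_def using ne mem by blast
  qed
  then obtain A where A1: "is_subring A" "Z \<subseteq> A" "inverse q \<notin> A"
    and maxA: "\<And>B. is_subring B \<Longrightarrow> Z \<subseteq> B \<Longrightarrow> inverse q \<notin> B \<Longrightarrow> A \<subseteq> B \<Longrightarrow> B = A"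
    unfolding \<A>_def by auto
  interpret maximal_subring A q
  proof
    show "B = A" if "is_subring B" "A \<subseteq> B" "inverse q \<notin> B" for B
      using maxA[OF that(1) _ that(3,2)] A1(2) that(2) by blast
  qed (use A1 q in auto)
  from that[OF A1 mem_or_inverse_mem] show ?thesis .
qed

section \<open>The units and the maximal ideal of a valuation ring\<close>

text \<open>\<open>A\<close> is a valuation ring, and the last assumption makes the characteristic
  of its residue field equal to \<open>p\<close>.\<close>

locale valued_field =
  fixes A :: "'a::field set" and p :: nat
  assumes A: "is_subring A" and mem_or_inverse_mem: "\<And>x. x \<in> A \<or> inverse x \<in> A"
    and prime_p: "Factorial_Ring.prime p" and inverse_p: "inverse (of_nat p) \<notin> A"
begin

abbreviation P :: 'a where "P \<equiv> of_nat p"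

definition U :: "'a set" where "U = {x \<in> A. x \<noteq> 0 \<and> inverse x \<in> A}"

definition \<mm> :: "'a set" where "\<mm> = A - U"

lemmas A_intros = is_subringD[OF A] subring_power[OF A] subring_sum[OF A] subring_prod[OF A]
  subring_of_nat[OF A] subring_of_int[OF A]

lemma P_nonzero: "P \<noteq> 0"
  using inverse_p A_intros(2) by (metis inverse_zero)

lemma U_1: "1 \<in> U"
  by (auto simp: U_def intro: A_intros)

lemma U_nonzero: "x \<in> U \<Longrightarrow> x \<noteq> 0"
  by (simp add: U_def)

lemma U_subset: "x \<in> U \<Longrightarrow> x \<in> A"
  by (simp add: U_def)

lemma U_mult: "x \<in> U \<Longrightarrow> y \<in> U \<Longrightarrow> x * y \<in> U"
  by (auto simp: U_def intro: A_intros)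

lemma U_inverse: "x \<in> U \<Longrightarrow> inverse x \<in> U"
  by (auto simp: U_def)

lemma U_divide: "x \<in> U \<Longrightarrow> y \<in> U \<Longrightarrow> x / y \<in> U"
  unfolding divide_inverse by (intro U_mult U_inverse)

lemma U_power: "x \<in> U \<Longrightarrow> x ^ n \<in> U"
  by (induction n) (auto intro: U_1 U_mult)

lemma \<mm>_subset: "x \<in> \<mm> \<Longrightarrow> x \<in> A"
  by (simp add: \<mm>_def)

lemma \<mm>_iff: "x \<in> \<mm> \<longleftrightarrow> x = 0 \<or> inverse x \<notin> A"
  using mem_or_inverse_mem[of x] A_intros(2) by (auto simp: \<mm>_def U_def)

lemma one_notin_\<mm>: "1 \<notin> \<mm>"
  using U_1 by (simp add: \<mm>_def)

lemma P_\<mm>: "P \<in> \<mm>"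
  by (simp add: \<mm>_iff inverse_p)

lemma \<mm>_mult: "x \<in> A \<Longrightarrow> y \<in> \<mm> \<Longrightarrow> x * y \<in> \<mm>"
proof (cases "x * y = 0")
  case False
  assume *: "x \<in> A" "y \<in> \<mm>"
  have "inverse y = x * inverse (x * y)" using False by simp
  then show ?thesis using * A_intros(4)[of x "inverse (x * y)"] False by (metis \<mm>_iff mult_zero_right)
qed (simp add: \<mm>_iff)

lemma \<mm>_mult': "x \<in> \<mm> \<Longrightarrow> y \<in> A \<Longrightarrow> x * y \<in> \<mm>"
  using \<mm>_mult[of y x] by (simp add: mult.commute)

lemma \<mm>_0: "0 \<in> \<mm>"
  by (simp add: \<mm>_iff)

text \<open>One of \<open>y / x\<close> and \<open>x / y\<close> lies in \<open>A\<close>, so the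
  sum is an \<open>A\<close>-multiple of \<open>x\<close> or of \<open>y\<close>.\<close>

lemma \<mm>_add: "x \<in> \<mm> \<Longrightarrow> y \<in> \<mm> \<Longrightarrow> x + y \<in> \<mm>"
proof -
  have *: "x + y \<in> \<mm>" if "x \<in> \<mm>" "y \<in> \<mm>" "y * inverse x \<in> A" "x \<noteq> 0" for x y
  proof -
    have "x + y = (1 + y * inverse x) * x" using that by (simp add: field_simps)
    then show ?thesis using \<mm>_mult[of "1 + y * inverse x" x] that A_intros(1,3) by simp
  qed
  assume xy: "x \<in> \<mm>" "y \<in> \<mm>"
  show ?thesis
  proof (cases "x = 0 \<or> y = 0")
    case False
    then show ?thesis
      using mem_or_inverse_mem[of "y * inverse x"] *[OF xy] *[of y x] xy
      by (auto simp: add.commute mult.commute)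
  qed (use xy in auto)
qed

lemma \<mm>_minus: "x \<in> \<mm> \<Longrightarrow> - x \<in> \<mm>"
  using \<mm>_mult[of "- 1" x] A_intros(1,5) by simp

lemma \<mm>_diff: "x \<in> \<mm> \<Longrightarrow> y \<in> \<mm> \<Longrightarrow> x - y \<in> \<mm>"
  using \<mm>_add[of x "- y"] \<mm>_minus[of y] by simp

lemma \<mm>_sum: "(\<And>i. i \<in> S \<Longrightarrow> f i \<in> \<mm>) \<Longrightarrow> sum f S \<in> \<mm>"
  by (induction S rule: infinite_finite_induct) (auto intro: \<mm>_add \<mm>_0)

lemma A_cases: "x \<in> A \<Longrightarrow> x \<notin> U \<Longrightarrow> x \<in> \<mm>"
  by (simp add: \<mm>_def)

lemma U_notin_\<mm>: "x \<in> U \<Longrightarrow> x \<notin> \<mm>"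
  by (simp add: \<mm>_def)

lemma \<mm>_prime: "x * y \<in> \<mm> \<Longrightarrow> x \<in> A \<Longrightarrow> y \<in> A \<Longrightarrow> x \<in> \<mm> \<or> y \<in> \<mm>"
  using A_cases U_mult U_notin_\<mm> by metis

lemma \<mm>_prime_prod:
  "finite S \<Longrightarrow> prod f S \<in> \<mm> \<Longrightarrow> (\<And>i. i \<in> S \<Longrightarrow> f i \<in> A) \<Longrightarrow> \<exists>i\<in>S. f i \<in> \<mm>"
proof (induction S rule: finite_induct)
  case empty
  then show ?case using one_notin_\<mm> by simp
next
  case (insert x S)
  then show ?case using \<mm>_prime[of "f x" "prod f S"] A_intros(9)[of S f] by auto
qed

lemma U_add_\<mm>: "x \<in> U \<Longrightarrow> y \<in> \<mm> \<Longrightarrow> x + y \<in> U"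
proof (rule ccontr)
  assume *: "x \<in> U" "y \<in> \<mm>" "x + y \<notin> U"
  then have "x + y \<in> \<mm>" by (intro A_cases A_intros) (auto intro: U_subset \<mm>_subset)
  then have "x + y - y \<in> \<mm>" using * by (intro \<mm>_diff)
  then show False using * U_notin_\<mm> by simp
qed

lemma mem_U_cong: "x - y \<in> \<mm> \<Longrightarrow> y \<in> U \<Longrightarrow> x \<in> U"
  using U_add_\<mm>[of y "x - y"] by simp

lemma cong_mult:
  assumes "x - y \<in> \<mm>" "x' - y' \<in> \<mm>" "x \<in> A" "y' \<in> A"
  shows "x * x' - y * y' \<in> \<mm>"
proof -
  have "x * x' - y * y' = x * (x' - y') + (x - y) * y'" by (simp add: algebra_simps)
  then show ?thesis using assms by (auto intro: \<mm>_add \<mm>_mult \<mm>_mult')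
qed

lemma cong_power:
  assumes "x - y \<in> \<mm>" "x \<in> A" "y \<in> A"
  shows "x ^ n - y ^ n \<in> \<mm>"
proof (induction n)
  case (Suc n)
  then show ?case using assms by (auto intro!: cong_mult A_intros)
qed (simp add: \<mm>_0)

lemma cong_sym: "x - y \<in> \<mm> \<Longrightarrow> y - x \<in> \<mm>"
  using \<mm>_minus[of "x - y"] by simp

lemma cong_trans: "x - y \<in> \<mm> \<Longrightarrow> y - z \<in> \<mm> \<Longrightarrow> x - z \<in> \<mm>"
  using \<mm>_add[of "x - y" "y - z"] by simp

lemma cong_divide_1: "x - y \<in> \<mm> \<Longrightarrow> y \<in> U \<Longrightarrow> x / y - 1 \<in> \<mm>"
proof -
  assume *: "x - y \<in> \<mm>" "y \<in> U"
  have "x / y - 1 = (x - y) * inverse y" using U_nonzero[OF *(2)] by (simp add: field_simps)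
  then show ?thesis using * by (auto intro!: \<mm>_mult' U_subset U_inverse)
qed

text \<open>By Bezout some multiple of \<open>n\<close> is \<open>1\<close> minus a multiple of
  \<open>p\<close>, hence a unit.\<close>

lemma of_int_U:
  assumes "coprime n (int p)"
  shows "of_int n \<in> U"
proof -
  obtain a b where "a * n + b * int p = 1"
    using assms by (metis bezout_int coprime_iff_gcd_eq_1)
  then have "(of_int a * of_int n + of_int b * P :: 'a) = 1"
    by (metis of_int_1 of_int_add of_int_mult of_int_of_nat_eq)
  then have "of_int a * of_int n = 1 + - (of_int b * P)"
    by (simp add: algebra_simps)
  also have "\<dots> \<in> U"
    by (intro U_add_\<mm> \<mm>_minus \<mm>_mult A_intros U_1 P_\<mm>)
  finally show ?thesis
    using A_cases[of "of_int n"] \<mm>_mult[of "of_int a" "of_int n"] U_notin_\<mm> A_intros(11) by metis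
qed

text \<open>In a vanishing sum the least value is attained twice: after division by a term
  \<open>t k\<close> of least value the other terms add up to \<open>- 1\<close>, so they cannot all
  lie in \<mm>.\<close>

lemma exists_tie:
  assumes "finite S" "S \<noteq> {}" "\<And>i. i \<in> S \<Longrightarrow> t i \<noteq> 0" "sum t S = 0"
  shows "\<exists>i\<in>S. \<exists>j\<in>S. i \<noteq> j \<and> t i / t j \<in> U"
proof -
  have ex: "\<exists>k\<in>S. \<forall>i\<in>S. t i / t k \<in> A"
    using assms(1-3)
  proof (induction S rule: finite_ne_induct)
    case (singleton x)
    then show ?case using A_intros(1) by auto
  next
    case (insert x S)
    then obtain k where k: "k \<in> S" "\<forall>i\<in>S. t i / t k \<in> A" by auto
    show ?case
    proof (cases "t x / t k \<in> A")
      case True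
      then show ?thesis using k by auto
    next
      case False
      then have kx: "t k / t x \<in> A" using mem_or_inverse_mem[of "t x / t k"] by simp
      have "t i / t x \<in> A" if "i \<in> S" for i
      proof -
        have "t i / t x = (t i / t k) * (t k / t x)" using insert.prems k by auto
        then show ?thesis using k kx that A_intros(4) by metis
      qed
      then show ?thesis using insert.prems[of x] A_intros(1) by (intro bexI[of _ x]) auto
    qed
  qed
  then obtain k where k: "k \<in> S" "\<forall>i\<in>S. t i / t k \<in> A" by blast
  have "0 = sum t S / t k" using assms by simp
  also have "\<dots> = (\<Sum>i\<in>S. t i / t k)" by (rule sum_divide_distrib)
  also have "\<dots> = 1 + (\<Sum>i\<in>S - {k}. t i / t k)"
    using assms k by (subst sum.remove[of _ k]) auto
  finally have "(\<Sum>i\<in>S - {k}. t i / t k) = - 1" by (simp add: eq_neg_iff_add_eq_0 add.commute)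
  then have "(\<Sum>i\<in>S - {k}. t i / t k) \<notin> \<mm>" using one_notin_\<mm> \<mm>_minus[of "- 1"] by auto
  then obtain i where "i \<in> S - {k}" "t i / t k \<notin> \<mm>"
    using \<mm>_sum[of "S - {k}" "\<lambda>i. t i / t k"] by auto
  with k A_cases[of "t i / t k"] show ?thesis by (intro bexI[of _ i] bexI[of _ k]) auto
qed

end

section \<open>Valuations above a complete discrete valuation ring\<close>

text \<open>\<open>Z\<close> stands for the \<open>p\<close>-adic integers: a complete discrete
  valuation ring with uniformizer \<open>p\<close> and a residue field of \<open>p\<close> elements.
  The ambient field is algebraic over it.\<close>

locale valued_extension = valued_field A p for A :: "'a::field set" and p +
  fixes Z :: "'a set"
  assumes Z: "is_subring Z" and Z_subset: "Z \<subseteq> A"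
    and factorization: "z \<in> Z \<Longrightarrow> z \<noteq> 0 \<Longrightarrow> \<exists>k u. z = of_nat p ^ k * u \<and> u \<in> Z \<and> inverse u \<in> Z"
    and residue_field: "z \<in> Z \<Longrightarrow> \<exists>y\<in>Z. z ^ p - z = of_nat p * y"
    and complete: "(\<And>k. a k \<in> Z) \<Longrightarrow> \<exists>s\<in>Z. \<forall>N. \<exists>t\<in>Z. s - (\<Sum>k<N. of_nat p ^ k * a k) = of_nat p ^ N * t"
    and algebraic: "\<exists>f. f \<noteq> 0 \<and> (\<forall>i. coeff f i \<in> Z) \<and> poly f x = 0"
begin

lemmas Z_intros = is_subringD[OF Z] subring_power[OF Z] subring_sum[OF Z] subring_prod[OF Z]
  subring_of_nat[OF Z] subring_of_int[OF Z]

lemma factorization':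
  assumes "z \<in> Z" "z \<noteq> 0"
  shows "\<exists>k u. z = P ^ k * u \<and> u \<in> Z \<and> inverse u \<in> Z \<and> u \<in> U"
proof -
  from factorization[OF assms] obtain k u where ku: "z = P ^ k * u" "u \<in> Z" "inverse u \<in> Z"
    by blast
  then have "u \<in> U" using assms Z_subset by (auto simp: U_def)
  with ku show ?thesis by blast
qed

lemma P_power_\<mm>: "n > 0 \<Longrightarrow> P ^ n \<in> \<mm>"
  by (cases n) (auto intro!: \<mm>_mult' P_\<mm> A_intros)

section \<open>The rational-valued valuation\<close>

lemma P_powi_U: "P powi k \<in> U \<Longrightarrow> k = 0"
proof (rule ccontr)
  assume *: "P powi k \<in> U" "k \<noteq> 0"
  then have "P ^ nat \<bar>k\<bar> \<in> U"
    using U_inverse[OF *(1)] by (cases "k > 0") (auto simp: power_int_def power_inverse)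
  then show False using P_power_\<mm>[of "nat \<bar>k\<bar>"] U_notin_\<mm> * by auto
qed

text \<open>Two terms of an algebraic relation for \<open>x\<close> differ by a unit factor, by
  \<open>exists_tie\<close>. Up to units their coefficients are powers of \<open>p\<close>, so a
  positive power of \<open>x\<close> is a power of \<open>p\<close> as well; its exponent defines
  \<open>v x\<close>.\<close>

lemma power_mult_P_mem_U:
  assumes x: "x \<noteq> 0"
  shows "\<exists>n>0. \<exists>k::int. x ^ n * P powi k \<in> U"
proof -
  obtain f where f: "f \<noteq> 0" "\<And>i. coeff f i \<in> Z" "poly f x = 0"
    using algebraic by blast
  define S where "S = {i. coeff f i \<noteq> 0}"
  define t where "t = (\<lambda>i. coeff f i * x ^ i)"
  have S: "S \<subseteq> {..Polynomial.degree f}" unfolding S_def by (auto intro: le_degree)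
  have "sum t S = (\<Sum>i\<le>Polynomial.degree f. t i)"
    using S by (intro sum.mono_neutral_left) (auto simp: S_def t_def)
  also have "\<dots> = 0" using f(3) by (simp add: poly_altdef t_def)
  finally have sum: "sum t S = 0" .
  have "coeff f (Polynomial.degree f) \<noteq> 0" using f(1) by simp
  then have "S \<noteq> {}" unfolding S_def by blast
  have "\<exists>i\<in>S. \<exists>j\<in>S. i \<noteq> j \<and> t i / t j \<in> U"
    by (rule exists_tie[OF _ \<open>S \<noteq> {}\<close> _ sum]) (use S finite_subset x in \<open>auto simp: S_def t_def\<close>)
  then obtain i j where ij: "i \<in> S" "j \<in> S" "i \<noteq> j" "t i / t j \<in> U" by blast
  have *: ?thesis if ij: "i \<in> S" "j \<in> S" "i < j" "t j / t i \<in> U" for i j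
  proof -
    obtain a u where a: "coeff f i = P ^ a * u" "u \<in> U"
      using factorization'[of "coeff f i"] f(2) ij(1) unfolding S_def by blast
    obtain b w where b: "coeff f j = P ^ b * w" "w \<in> U"
      using factorization'[of "coeff f j"] f(2) ij(2) unfolding S_def by blast
    have "x ^ j = x ^ (j - i) * x ^ i" using ij(3) by (simp flip: power_add)
    then have "x ^ (j - i) * P powi (int b - int a) = (t j / t i) * (u / w)"
      using x P_nonzero U_nonzero[OF a(2)] U_nonzero[OF b(2)]
      by (simp add: t_def a b power_int_diff field_simps)
    also have "\<dots> \<in> U" by (intro U_mult U_divide ij a b)
    finally show ?thesis using ij(3) zero_less_diff by blast
  qed
  show ?thesis
  proof (cases "i < j")
    case True
    then show ?thesis using *[OF ij(1,2)] U_inverse[OF ij(4)] by simp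
  next
    case False
    then show ?thesis using *[OF ij(2,1)] ij by simp
  qed
qed

text \<open>The value \<open>v 0\<close> is arbitrary.\<close>

definition v :: "'a \<Rightarrow> rat" where
  "v x = (SOME q. \<exists>n>0. \<exists>k::int. x ^ n * P powi k \<in> U \<and> q = - of_int k / of_nat n)"

lemma v_obtain:
  assumes "x \<noteq> 0"
  obtains n k where "n > 0" "x ^ n * P powi k \<in> U" "v x = - of_int k / of_nat n"
proof -
  have "\<exists>q. \<exists>n>0. \<exists>k::int. x ^ n * P powi k \<in> U \<and> q = - rat_of_int k / of_nat n"
    using power_mult_P_mem_U[OF assms] by blast
  from someI_ex[OF this] that show ?thesis unfolding v_def by blast
qed

text \<open>Independence of the choice: two representations of \<open>x\<close> show that
  \<open>P powi (k * m - l * n)\<close> is a unit, so the exponent is \<open>0\<close> and both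
  fractions agree.\<close>

lemma v_eqI:
  assumes n: "n > 0" and xn: "x ^ n * P powi k \<in> U"
  shows "v x = - of_int k / of_nat n"
proof -
  have x: "x \<noteq> 0" using U_nonzero[OF xn] n by auto
  obtain m l where m: "m > 0" "x ^ m * P powi l \<in> U" "v x = - of_int l / of_nat m"
    using v_obtain[OF x] .
  have "P powi (k * int m - l * int n) = (x ^ n * P powi k) ^ m / (x ^ m * P powi l) ^ n"
    using x P_nonzero
    by (simp add: power_int_diff power_int_mult power_mult_distrib power_mult[symmetric] mult.commute)
  also have "\<dots> \<in> U" by (intro U_divide U_power xn m)
  finally have "k * int m = l * int n" using P_powi_U by fastforce
  then have "rat_of_int k * of_nat m = of_int l * of_nat n"
    by (metis of_int_mult of_int_of_nat_eq)
  then show ?thesis using m(1) n by (simp add: m(3) field_simps)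
qed

lemma v_mult:
  assumes "x \<noteq> 0" "y \<noteq> 0"
  shows "v (x * y) = v x + v y"
proof -
  obtain m l where m: "m > 0" "x ^ m * P powi l \<in> U" "v x = - of_int l / of_nat m"
    using v_obtain[OF assms(1)] .
  obtain n k where n: "n > 0" "y ^ n * P powi k \<in> U" "v y = - of_int k / of_nat n"
    using v_obtain[OF assms(2)] .
  have "(x * y) ^ (m * n) * P powi (l * int n + k * int m)
      = (x ^ m * P powi l) ^ n * (y ^ n * P powi k) ^ m"
    using P_nonzero
    by (simp add: power_int_add power_int_mult power_mult_distrib power_mult[symmetric] mult_ac)
  also have "\<dots> \<in> U" by (intro U_mult U_power m n)
  finally have "v (x * y) = - of_int (l * int n + k * int m) / of_nat (m * n)"
    using m n by (intro v_eqI) auto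
  then show ?thesis using m(1) n(1) by (simp add: m(3) n(3) field_simps)
qed

lemma v_U: "x \<in> U \<Longrightarrow> v x = 0"
  using v_eqI[of 1 x 0] by simp

lemma v_P: "v P = 1"
  using v_eqI[of 1 P "- 1"] P_nonzero U_1 by (simp add: power_int_minus)

lemma v_inverse: "x \<noteq> 0 \<Longrightarrow> v (inverse x) = - v x"
  using v_mult[of x "inverse x"] v_U[OF U_1] by simp

lemma v_divide: "x \<noteq> 0 \<Longrightarrow> y \<noteq> 0 \<Longrightarrow> v (x / y) = v x - v y"
  using v_mult[of x "inverse y"] v_inverse[of y] by (simp add: divide_inverse)

lemma v_power: "x \<noteq> 0 \<Longrightarrow> v (x ^ n) = of_nat n * v x"
  by (induction n) (auto simp: v_U[OF U_1] v_mult algebra_simps)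

lemma v_power_int: "x \<noteq> 0 \<Longrightarrow> v (x powi k) = of_int k * v x"
  by (cases k rule: int_cases3) (auto simp: power_int_minus v_inverse v_power v_U[OF U_1])

lemma v_nonneg:
  assumes "x \<in> A" "x \<noteq> 0"
  shows "v x \<ge> 0"
proof -
  obtain n k where n: "n > 0" "x ^ n * P powi k \<in> U" "v x = - of_int k / of_nat n"
    using v_obtain[OF assms(2)] .
  have "k \<le> 0"
  proof (rule ccontr)
    assume k: "\<not> k \<le> 0"
    then have "P powi k \<in> \<mm>" using P_power_\<mm>[of "nat k"] by (simp add: power_int_def)
    then have "x ^ n * P powi k \<in> \<mm>" using assms by (intro \<mm>_mult A_intros)
    then show False using n U_notin_\<mm> by blast
  qed
  then show ?thesis using n(1) by (simp add: n(3) field_simps)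
qed

lemma v_pos:
  assumes "x \<in> \<mm>" "x \<noteq> 0"
  shows "v x > 0"
proof -
  obtain n k where n: "n > 0" "x ^ n * P powi k \<in> U" "v x = - of_int k / of_nat n"
    using v_obtain[OF assms(2)] .
  have "x ^ n \<in> \<mm>" using n(1) assms
    by (cases n) (auto intro!: \<mm>_mult' A_intros intro: \<mm>_subset)
  then have "k \<noteq> 0" using n U_notin_\<mm> by auto
  then have "v x \<noteq> 0" using n by simp
  then show ?thesis using v_nonneg[of x] assms \<mm>_subset by force
qed

lemma U_iff: "x \<in> U \<longleftrightarrow> x \<noteq> 0 \<and> v x = 0"
proof
  assume x: "x \<noteq> 0 \<and> v x = 0"
  then have "x \<notin> \<mm>" "inverse x \<notin> \<mm>"
    using v_pos[of x] v_pos[of "inverse x"] v_inverse[of x] by auto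
  then show "x \<in> U"
    using A_cases[of x] A_cases[of "inverse x"] U_inverse[of "inverse x"] mem_or_inverse_mem[of x] by auto
qed (use v_U U_nonzero in auto)

lemma \<mm>_iff_v: "x \<in> \<mm> \<longleftrightarrow> x = 0 \<or> v x > 0"
  using v_pos[of x] \<mm>_0 v_nonneg[of "inverse x"] v_inverse[of x] mem_or_inverse_mem[of x]
    A_cases[of x] v_U[of x] by (cases "x = 0") fastforce+

text \<open>The value of a nonzero \<open>x\<close> is a rational number, hence less than some
  natural number \<open>N\<close>.\<close>

lemma infinitely_divisible_eq_0:
  assumes "\<And>N. \<exists>y\<in>A. x = P ^ N * y"
  shows "x = 0"
proof (rule ccontr)
  assume x: "x \<noteq> 0"
  obtain N where N: "v x < of_nat N" using reals_Archimedean2 by blast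
  obtain y where y: "y \<in> A" "x = P ^ N * y" using assms by blast
  have "v x = of_nat N + v y" using x y P_nonzero by (simp add: v_mult v_power v_P)
  then show False using v_nonneg[of y] y x N by simp
qed

section \<open>Integrality over \<open>Z\<close>\<close>

lemma integral_mem_A:
  assumes "\<And>i. i < r \<Longrightarrow> s i \<in> A" "z ^ r = (\<Sum>i<r. s i * z ^ i)"
  shows "z \<in> A"
proof (rule ccontr)
  assume "z \<notin> A"
  then have z: "z \<noteq> 0" "inverse z \<in> \<mm>" using A_intros(2) by (auto simp: \<mm>_iff)
  \<comment> \<open>Divided by \<open>z ^ r\<close>, the relation writes \<open>1\<close> as a sum
    of multiples of \<open>inverse z\<close>, which lies in \<mm>.\<close>
  have "1 = (\<Sum>i<r. s i * z ^ i) / z ^ r" unfolding assms(2)[symmetric] using z by simp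
  also have "\<dots> = (\<Sum>i<r. s i * inverse z ^ (r - i))"
    unfolding sum_divide_distrib
  proof (intro sum.cong refl)
    fix i assume "i \<in> {..<r}"
    then have "z ^ r = z ^ i * z ^ (r - i)" by (simp flip: power_add)
    then show "s i * z ^ i / z ^ r = s i * inverse z ^ (r - i)"
      using z by (simp add: field_simps)
  qed
  also have "\<dots> \<in> \<mm>"
  proof (intro \<mm>_sum)
    fix i assume i: "i \<in> {..<r}"
    then obtain d where d: "r - i = Suc d" by (metis Suc_diff_Suc lessThan_iff)
    show "s i * inverse z ^ (r - i) \<in> \<mm>"
      unfolding d power_Suc using i assms z by (intro \<mm>_mult \<mm>_mult' A_intros) (auto intro: \<mm>_subset)
  qed
  finally show False using one_notin_\<mm> by simp
qed

text \<open>Division by a coefficient of least valuation makes that coefficient \<open>1\<close>. If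
  \<open>r\<close> is the last such index, all later coefficients are multiples of \<open>p\<close>,
  so the relation is monic of degree \<open>r\<close> modulo \<open>p\<close>.\<close>

lemma primitive_relation:
  obtains f r where "\<And>i. coeff f i \<in> Z" "poly f y = 0" "coeff f r = 1"
    "\<And>i. i > r \<Longrightarrow> \<exists>d\<in>Z. coeff f i = P * d"
proof -
  obtain f where f: "f \<noteq> 0" "\<And>i. coeff f i \<in> Z" "poly f y = 0"
    using algebraic by blast
  define S where "S = {i. coeff f i \<noteq> 0}"
  have "S \<subseteq> {..Polynomial.degree f}" unfolding S_def by (auto intro: le_degree)
  then have finS: "finite S" using finite_subset by blast
  have "coeff f (Polynomial.degree f) \<noteq> 0" using f(1) by simp
  then have neS: "S \<noteq> {}" unfolding S_def by blast
  have "\<forall>i\<in>S. \<exists>k u. coeff f i = P ^ k * u \<and> u \<in> Z \<and> inverse u \<in> Z"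
    using factorization f(2) unfolding S_def by blast
  then obtain k u where ku: "\<And>i. i \<in> S \<Longrightarrow> coeff f i = P ^ k i * u i"
    "\<And>i. i \<in> S \<Longrightarrow> u i \<in> Z" "\<And>i. i \<in> S \<Longrightarrow> inverse (u i) \<in> Z" by metis
  define k0 where "k0 = Min (k ` S)"
  have k0: "k0 \<le> k i" if "i \<in> S" for i using that finS by (simp add: k0_def)
  have "k0 \<in> k ` S" unfolding k0_def using finS neS by (intro Min_in) auto
  define r where "r = Max {i \<in> S. k i = k0}"
  have r: "r \<in> {i \<in> S. k i = k0}"
    unfolding r_def using finS \<open>k0 \<in> k ` S\<close> by (intro Max_in) auto
  have r': "k i > k0" if "i > r" "i \<in> S" for i
  proof (rule ccontr)
    assume "\<not> k i > k0"
    then have "i \<in> {i \<in> S. k i = k0}" using k0[OF that(2)] that(2) by simp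
    then have "i \<le> r" unfolding r_def using finS by (intro Max_ge) auto
    then show False using that(1) by simp
  qed
  define g where "g = smult (inverse (coeff f r)) f"
  have cg: "coeff g i = P ^ (k i - k0) * (u i * inverse (u r))" if "i \<in> S" for i
  proof -
    have "P ^ k i = P ^ (k i - k0) * P ^ k0" using k0[OF that] by (simp flip: power_add)
    then show ?thesis using that r P_nonzero by (simp add: g_def ku)
  qed
  have cg0: "coeff g i = 0" if "i \<notin> S" for i using that by (simp add: g_def S_def)
  have "\<exists>d\<in>Z. coeff g i = P * d" if "i > r" for i
  proof (cases "i \<in> S")
    case True
    then have "coeff g i = P * (P ^ (k i - k0 - 1) * (u i * inverse (u r)))"
      using r'[OF that True] by (simp add: cg[OF True] mult.assoc[symmetric] Suc_diff_Suc flip: power_Suc)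
    moreover have "P ^ (k i - k0 - 1) * (u i * inverse (u r)) \<in> Z"
      using True r by (intro Z_intros ku) auto
    ultimately show ?thesis by blast
  next
    case False
    then show ?thesis using cg0 Z_intros(2) by auto
  qed
  moreover have "coeff g i \<in> Z" for i
    using r cg0[of i] cg[of i] by (cases "i \<in> S") (auto intro!: Z_intros ku)
  moreover have "coeff g r = 1" using r by (simp add: g_def S_def)
  moreover have "poly g y = 0" using f by (simp add: g_def)
  ultimately show ?thesis using that by blast
qed

text \<open>A relation that is monic modulo \<open>p\<close> shows that \<open>1, y, \<dots>, y ^ (r - 1)\<close> generate \<open>Z[y]\<close>
  modulo \<open>p\<close>; by completeness they generate it, up to infinitely divisible elements.\<close>

lemma integral_over_Z:
  assumes y: "y \<in> A"
  shows "\<exists>r s. (\<forall>i. s i \<in> Z) \<and> y ^ r = (\<Sum>i<r. s i * y ^ i)"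
proof -
  obtain f r where f: "\<And>i. coeff f i \<in> Z" "poly f y = 0" "coeff f r = 1"
    "\<And>i. i > r \<Longrightarrow> \<exists>d\<in>Z. coeff f i = P * d" using primitive_relation[of y] by blast
  define D where "D = adjoin Z y"
  have D: "is_subring D" "Z \<subseteq> D" "y \<in> D"
    unfolding D_def by (intro is_subring_adjoin subset_adjoin mem_adjoin Z)+
  \<comment> \<open>This keeps all remainders of the expansion below in \<open>A\<close>, where
    \<open>infinitely_divisible_eq_0\<close> applies.\<close>
  have D_subset: "D \<subseteq> A"
    unfolding D_def adjoin_def using Z_subset y by (auto intro!: subring_poly[OF A])
  \<comment> \<open>\<open>N\<close> consists of the \<open>Z\<close>-combinations of
    \<open>1, ..., y ^ (r - 1)\<close> plus \<open>P * D\<close>. It contains all powers of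
    \<open>y\<close> because it contains \<open>y ^ r\<close> and is stable under multiplication by
    \<open>y\<close>.\<close>
  define N where "N = {z. \<exists>a. (\<forall>i. a i \<in> Z) \<and> (\<exists>w\<in>D. z = (\<Sum>i<r. a i * y ^ i) + P * w)}"
  note D_intros = is_subringD[OF D(1)] subring_power[OF D(1)] subring_sum[OF D(1)] subring_of_nat[OF D(1)] D(3)
  have N_add: "z + z' \<in> N" if zN: "z \<in> N" "z' \<in> N" for z z'
  proof -
    obtain a w where "\<And>i. a i \<in> Z" "w \<in> D" "z = (\<Sum>i<r. a i * y ^ i) + P * w"
      using zN(1) unfolding N_def by blast
    moreover obtain a' w' where "\<And>i. a' i \<in> Z" "w' \<in> D" "z' = (\<Sum>i<r. a' i * y ^ i) + P * w'"
      using zN(2) unfolding N_def by blast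
    ultimately have "(\<forall>i. a i + a' i \<in> Z) \<and> (w + w' \<in> D \<and> z + z' = (\<Sum>i<r. (a i + a' i) * y ^ i) + P * (w + w'))"
      by (auto simp: algebra_simps sum.distrib intro: Z_intros D_intros)
    then show ?thesis unfolding N_def mem_Collect_eq by (intro exI[of _ "\<lambda>i. a i + a' i"]) blast
  qed
  have N_mult: "c * z \<in> N" if zN: "z \<in> N" "c \<in> Z" for z c
  proof -
    obtain a w where "\<And>i. a i \<in> Z" "w \<in> D" "z = (\<Sum>i<r. a i * y ^ i) + P * w"
      using zN unfolding N_def by blast
    then have "(\<forall>i. c * a i \<in> Z) \<and> (c * w \<in> D \<and> c * z = (\<Sum>i<r. (c * a i) * y ^ i) + P * (c * w))"
      using zN D(2) by (auto simp: algebra_simps sum_distrib_left intro!: Z_intros D_intros)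
    then show ?thesis unfolding N_def mem_Collect_eq by (intro exI[of _ "\<lambda>i. c * a i"]) blast
  qed
  have N_P: "P * w \<in> N" if "w \<in> D" for w
    unfolding N_def mem_Collect_eq using that Z_intros(2) by (intro exI[of _ "\<lambda>_. 0"]) auto
  have N_0: "0 \<in> N" using N_P[of 0] D_intros(2) by simp
  have N_sum: "sum g S \<in> N" if "\<And>i. i \<in> S \<Longrightarrow> g i \<in> N" for g and S :: "nat set"
    using that by (induction S rule: infinite_finite_induct) (auto intro: N_add N_0)
  have N_low: "y ^ n \<in> N" if "n < r" for n
    unfolding N_def mem_Collect_eq using that Z_intros(1,2) D_intros(2)
    by (intro exI[of _ "\<lambda>i. if i = n then 1 else 0"]) (auto simp: if_distrib[of "\<lambda>x. x * _"] cong: if_cong)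
  have N_r: "y ^ r \<in> N"
  proof -
    define d where "d = Polynomial.degree f"
    have "r \<le> d" unfolding d_def using f(3) by (intro le_degree) simp
    \<comment> \<open>The terms above \<open>r\<close> fall into \<open>P * D\<close>, their
      coefficients being multiples of \<open>p\<close>.\<close>
    then have split: "{..d} = {..<r} \<union> {r} \<union> {r<..d}" by auto
    have "0 = (\<Sum>i\<le>d. coeff f i * y ^ i)" using f(2) by (simp add: d_def poly_altdef)
    also have "\<dots> = (\<Sum>i<r. coeff f i * y ^ i) + y ^ r + (\<Sum>i\<in>{r<..d}. coeff f i * y ^ i)"
      unfolding split by (subst sum.union_disjoint; (subst sum.union_disjoint)?) (auto simp: f(3))
    finally have "y ^ r = - 1 * ((\<Sum>i<r. coeff f i * y ^ i) + (\<Sum>i\<in>{r<..d}. coeff f i * y ^ i))"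
      by (simp add: algebra_simps eq_neg_iff_add_eq_0)
    also have "\<dots> \<in> N"
    proof (rule N_mult[OF N_add[OF N_sum N_sum]])
      show "coeff f i * y ^ i \<in> N" if "i \<in> {..<r}" for i
        using that by (intro N_mult N_low f) auto
      fix i assume "i \<in> {r<..d}"
      then obtain e where "e \<in> Z" "coeff f i = P * e" using f(4)[of i] by auto
      then show "coeff f i * y ^ i \<in> N"
        using N_P[of "e * y ^ i"] D by (auto simp: mult.assoc intro: D_intros)
    qed (intro Z_intros)
    finally show ?thesis .
  qed
  have N_y: "y * z \<in> N" if zN: "z \<in> N" for z
  proof -
    obtain a w where a: "\<And>i. a i \<in> Z" "w \<in> D" "z = (\<Sum>i<r. a i * y ^ i) + P * w"
      using zN unfolding N_def by blast
    have "y * z = (\<Sum>i<r. a i * y ^ Suc i) + P * (y * w)"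
      by (simp add: a(3) algebra_simps sum_distrib_left)
    also have "\<dots> \<in> N"
    proof (rule N_add)
      have "y ^ Suc i \<in> N" if "i < r" for i
        using that N_low[of "Suc i"] N_r by (cases "Suc i = r") auto
      then show "(\<Sum>i<r. a i * y ^ Suc i) \<in> N" using a(1) by (intro N_sum N_mult) auto
      show "P * (y * w) \<in> N" using a(2) by (intro N_P D_intros)
    qed
    finally show ?thesis .
  qed
  have N_power: "y ^ n \<in> N" for n
    by (induction n) (use N_low[of 0] N_r N_y in \<open>cases "r = 0"; auto\<close>)+
  have "D \<subseteq> N"
    unfolding D_def adjoin_def poly_altdef by (auto intro!: N_sum N_mult N_power)
  then have "\<forall>z\<in>D. \<exists>a w. (\<forall>i. a i \<in> Z) \<and> w \<in> D \<and> z = (\<Sum>i<r. a i * y ^ i) + P * w"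
    unfolding N_def by blast
  then obtain a w where aw: "\<And>z i. z \<in> D \<Longrightarrow> a z i \<in> Z" "\<And>z. z \<in> D \<Longrightarrow> w z \<in> D"
    "\<And>z. z \<in> D \<Longrightarrow> z = (\<Sum>i<r. a z i * y ^ i) + P * w z" by metis
  \<comment> \<open>\<open>W k\<close> is the remainder after \<open>k\<close> expansions. The
    coefficients of the successive remainders are the terms of the \<open>p\<close>-adic series with
    limits \<open>s i\<close>.\<close>
  define W where "W = (\<lambda>k. (w ^^ k) (y ^ r))"
  have W: "W k \<in> D" for k
    by (induction k) (auto simp: W_def intro: aw D_intros)
  have W_Suc: "W k = (\<Sum>i<r. a (W k) i * y ^ i) + P * W (Suc k)" for k
  proof -
    have "W (Suc k) = w (W k)" by (simp add: W_def)
    then show ?thesis by (simp only:) (rule aw(3)[OF W])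
  qed
  have expand: "y ^ r = (\<Sum>i<r. (\<Sum>k<M. P ^ k * a (W k) i) * y ^ i) + P ^ M * W M" for M
  proof (induction M)
    case (Suc M)
    have "P ^ M * W M = P ^ M * ((\<Sum>i<r. a (W M) i * y ^ i) + P * W (Suc M))"
      by (rule arg_cong[OF W_Suc])
    with Suc.IH show ?case
      by (simp add: algebra_simps sum.distrib sum_distrib_left)
  qed (simp add: W_def)
  have "\<forall>i. \<exists>s\<in>Z. \<forall>M. \<exists>t\<in>Z. s - (\<Sum>k<M. P ^ k * a (W k) i) = P ^ M * t"
    by (intro allI complete aw W)
  then obtain s where s: "\<And>i. s i \<in> Z" "\<And>i M. \<exists>t\<in>Z. s i - (\<Sum>k<M. P ^ k * a (W k) i) = P ^ M * t"
    by metis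
  have "y ^ r - (\<Sum>i<r. s i * y ^ i) = 0"
  proof (rule infinitely_divisible_eq_0)
    fix M
    have "\<forall>i. \<exists>t\<in>Z. s i - (\<Sum>k<M. P ^ k * a (W k) i) = P ^ M * t"
      by (intro allI s(2))
    then obtain t where t: "\<And>i. t i \<in> Z" "\<And>i. s i - (\<Sum>k<M. P ^ k * a (W k) i) = P ^ M * t i"
      by metis
    have s_eq: "s i = (\<Sum>k<M. P ^ k * a (W k) i) + P ^ M * t i" for i
      using t(2)[of i] by (simp add: algebra_simps)
    have "y ^ r - (\<Sum>i<r. s i * y ^ i) = P ^ M * (W M - (\<Sum>i<r. t i * y ^ i))"
      by (subst expand[of M]) (simp add: s_eq algebra_simps sum.distrib sum_distrib_left)
    moreover have "W M - (\<Sum>i<r. t i * y ^ i) \<in> A"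
      using W D_subset t(1) Z_subset y by (intro A_intros) auto
    ultimately show "\<exists>z\<in>A. y ^ r - (\<Sum>i<r. s i * y ^ i) = P ^ M * z" by blast
  qed
  then show ?thesis using s(1) by (intro exI[of _ r] exI[of _ s]) simp
qed

end

section \<open>Galois conjugates and symmetric functions\<close>

definition esym :: "'a::comm_ring_1 set \<Rightarrow> nat \<Rightarrow> 'a" where
  "esym S j = (\<Sum>T\<in>{T. T \<subseteq> S \<and> card T = j}. \<Prod>T)"

text \<open>Vieta's formula: the terms of the expanded product are indexed by subsets, which are
  grouped by cardinality.\<close>

lemma prod_diff_esym:
  fixes S :: "'a::comm_ring_1 set"
  assumes S: "finite S"
  shows "(\<Prod>x\<in>S. t - x) = (\<Sum>j\<le>card S. (- 1) ^ j * esym S j * t ^ (card S - j))"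
proof -
  have "(\<Prod>x\<in>S. t - x) = (\<Prod>x\<in>S. - 1 * x + t)" by simp
  also have "\<dots> = (\<Sum>T\<in>Pow S. (\<Prod>x\<in>T. - 1 * x) * (\<Prod>x\<in>S - T. t))"
    by (rule prod_add[OF S])
  also have "\<dots> = (\<Sum>T\<in>Pow S. (- 1) ^ card T * \<Prod>T * t ^ (card S - card T))"
    using S by (intro sum.cong refl)
      (auto simp: prod_uminus card_Diff_subset finite_subset)
  also have "\<dots> = (\<Sum>j\<le>card S. \<Sum>T\<in>{T \<in> Pow S. card T = j}. (- 1) ^ card T * \<Prod>T * t ^ (card S - card T))"
    using S by (intro sum.group[symmetric]) (auto intro: card_mono)
  also have "\<dots> = (\<Sum>j\<le>card S. (- 1) ^ j * esym S j * t ^ (card S - j))"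
    unfolding esym_def sum_distrib_left sum_distrib_right by (intro sum.cong refl) auto
  finally show ?thesis .
qed

context valued_field
begin

lemma freshman_dream:
  assumes "x \<in> A" "y \<in> A"
  shows "(x + y) ^ p - (x ^ p + y ^ p) \<in> \<mm>"
proof -
  have p: "p > 0" using prime_gt_0_nat[OF prime_p] .
  then have split: "{..p} = insert 0 (insert p {1..<p})" by auto
  have "(x + y) ^ p = (\<Sum>k\<le>p. of_nat (p choose k) * x ^ k * y ^ (p - k))"
    by (rule binomial_ring)
  also have "\<dots> = y ^ p + (x ^ p + (\<Sum>k\<in>{1..<p}. of_nat (p choose k) * x ^ k * y ^ (p - k)))"
    using p unfolding split by simp
  finally have "(x + y) ^ p - (x ^ p + y ^ p) = (\<Sum>k\<in>{1..<p}. of_nat (p choose k) * x ^ k * y ^ (p - k))"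
    by simp
  also have "\<dots> \<in> \<mm>"
  proof (intro \<mm>_sum)
    fix k assume k: "k \<in> {1..<p}"
    then have "p dvd p choose k" using prime_p by (intro dvd_choose_prime) auto
    then obtain d where d: "p choose k = d * p" by (metis dvd_def mult.commute)
    show "of_nat (p choose k) * x ^ k * y ^ (p - k) \<in> \<mm>"
      unfolding d of_nat_mult using assms by (intro \<mm>_mult' \<mm>_mult P_\<mm> A_intros)
  qed
  finally show ?thesis .
qed

lemma freshman_dream_sum:
  assumes "finite S" "\<And>i. i \<in> S \<Longrightarrow> f i \<in> A"
  shows "(\<Sum>i\<in>S. f i) ^ p - (\<Sum>i\<in>S. f i ^ p) \<in> \<mm>"
  using assms
proof (induction S rule: finite_induct)
  case empty
  then show ?case using prime_gt_0_nat[OF prime_p] by (simp add: \<mm>_0 power_0_left)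
next
  case (insert i S)
  have "(f i + sum f S) ^ p - (f i ^ p + sum f S ^ p) \<in> \<mm>"
    using insert.prems by (intro freshman_dream A_intros) auto
  moreover have "sum f S ^ p - (\<Sum>i\<in>S. f i ^ p) \<in> \<mm>" using insert by simp
  ultimately have "(f i + sum f S) ^ p - (f i ^ p + sum f S ^ p) + (sum f S ^ p - (\<Sum>i\<in>S. f i ^ p)) \<in> \<mm>"
    by (rule \<mm>_add)
  then show ?case using insert by (simp add: algebra_simps)
qed

lemma cong_prod_1:
  assumes "\<And>i. i \<in> S \<Longrightarrow> f i - 1 \<in> \<mm>"
  shows "prod f S - 1 \<in> \<mm>"
  using assms
proof (induction S rule: infinite_finite_induct)
  case (insert i S)
  have "f i \<in> A" using insert.prems[of i] U_1 by (auto intro: U_subset mem_U_cong)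
  then have "f i * prod f S - 1 * 1 \<in> \<mm>"
    using insert by (intro cong_mult A_intros) auto
  then show ?case using insert by simp
qed (simp_all add: \<mm>_0)

end

section \<open>Values of fractions over \<open>Z\<close>\<close>

context valued_extension
begin

lemma v_P_power_mult: "u \<in> U \<Longrightarrow> v (P ^ k * u) = of_nat k"
  using v_mult[of "P ^ k" u] v_power[of P k] by (simp add: P_nonzero v_P v_U U_nonzero)

lemma v_fraction:
  assumes "a \<in> Z" "b \<in> Z" "b \<noteq> 0" "a / b \<noteq> 0"
  shows "v (a / b) \<in> \<int>"
proof -
  have "a \<noteq> 0" using assms(4) by (metis div_0)
  then obtain k u where a: "a = P ^ k * u" "u \<in> U" using factorization'[OF assms(1)] by blast
  obtain l w where b: "b = P ^ l * w" "w \<in> U" using factorization'[OF assms(2,3)] by blast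
  have "v (a / b) = of_nat k - of_nat l"
    using v_divide[OF \<open>a \<noteq> 0\<close> assms(3)] v_P_power_mult[OF a(2)] v_P_power_mult[OF b(2)]
    unfolding a(1) b(1) by metis
  then show ?thesis by simp
qed

text \<open>The fraction is \<open>p\<close> to the power \<open>k - l\<close> times a unit of
  \<open>Z\<close>, and its value is nonnegative, so \<open>k\<close> is at least
  \<open>l\<close>.\<close>

lemma fraction_mem_Z:
  assumes "a \<in> Z" "b \<in> Z" "b \<noteq> 0" "a / b \<in> A"
  shows "a / b \<in> Z"
proof (cases "a = 0")
  case False
  obtain k u where a: "a = P ^ k * u" "u \<in> Z" "u \<in> U" using factorization'[OF assms(1) False] by blast
  obtain l w where b: "b = P ^ l * w" "inverse w \<in> Z" "w \<in> U" using factorization'[OF assms(2,3)] by blast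
  have "v (a / b) = of_nat k - of_nat l"
    using v_divide[OF False assms(3)] v_P_power_mult[OF a(3)] v_P_power_mult[OF b(3)]
    unfolding a(1) b(1) by metis
  moreover have "v (a / b) \<ge> 0" using assms False by (intro v_nonneg) auto
  ultimately have "k = (k - l) + l" by simp
  then have "P ^ k = P ^ (k - l) * P ^ l" by (metis power_add)
  then have "a / b = P ^ (k - l) * (u * inverse w)"
    unfolding a(1) b(1) using P_nonzero U_nonzero[OF b(3)] by (simp add: field_simps)
  also have "\<dots> \<in> Z" by (intro Z_intros a b)
  finally show ?thesis .
qed (use Z_intros(2) in simp)

end

text \<open>The maps in \<open>G\<close> matter only on \<open>F\<close>, so identity and
  composition are required pointwise there. \<open>G_fixed\<close> places the fixed elements in the
  fraction field of \<open>Z\<close>.\<close>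

locale galois_valued_extension = valued_extension A p Z for A :: "'a::field set" and p Z +
  fixes F :: "'a set" and G :: "('a \<Rightarrow> 'a) set"
  assumes F: "is_subring F" and F_inverse: "x \<in> F \<Longrightarrow> inverse x \<in> F" and Z_F: "Z \<subseteq> F"
    and G_F: "\<sigma> \<in> G \<Longrightarrow> x \<in> F \<Longrightarrow> \<sigma> x \<in> F"
    and G_add: "\<sigma> \<in> G \<Longrightarrow> x \<in> F \<Longrightarrow> y \<in> F \<Longrightarrow> \<sigma> (x + y) = \<sigma> x + \<sigma> y"
    and G_mult: "\<sigma> \<in> G \<Longrightarrow> x \<in> F \<Longrightarrow> y \<in> F \<Longrightarrow> \<sigma> (x * y) = \<sigma> x * \<sigma> y"
    and G_Z: "\<sigma> \<in> G \<Longrightarrow> z \<in> Z \<Longrightarrow> \<sigma> z = z"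
    and G_id: "\<exists>\<rho>\<in>G. \<forall>x\<in>F. \<rho> x = x"
    and G_comp: "\<sigma> \<in> G \<Longrightarrow> \<tau> \<in> G \<Longrightarrow> \<exists>\<rho>\<in>G. \<forall>x\<in>F. \<rho> x = \<sigma> (\<tau> x)"
    and G_commute: "\<sigma> \<in> G \<Longrightarrow> \<tau> \<in> G \<Longrightarrow> x \<in> F \<Longrightarrow> \<sigma> (\<tau> x) = \<tau> (\<sigma> x)"
    and G_fixed: "x \<in> F \<Longrightarrow> (\<And>\<sigma>. \<sigma> \<in> G \<Longrightarrow> \<sigma> x = x) \<Longrightarrow> \<exists>a\<in>Z. \<exists>b\<in>Z. b \<noteq> 0 \<and> x = a / b"
begin

lemma F_divide: "x \<in> F \<Longrightarrow> y \<in> F \<Longrightarrow> x / y \<in> F"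
  using subring_mult[OF F, of x "inverse y"] F_inverse[of y] by (simp add: divide_inverse)

lemmas F_intros = is_subringD[OF F] subring_power[OF F] subring_sum[OF F] subring_prod[OF F]
  subring_of_nat[OF F] F_inverse F_divide

lemma F_power_int: "x \<in> F \<Longrightarrow> x powi k \<in> F"
  by (simp add: power_int_def F_intros)

context
  fixes \<sigma> assumes \<sigma>: "\<sigma> \<in> G"
begin

lemma G_0: "\<sigma> 0 = 0" and G_1: "\<sigma> 1 = 1" and G_of_nat: "\<sigma> (of_nat n) = of_nat n"
  using G_Z[OF \<sigma>] Z_intros(1,2,10) by auto

lemma G_minus: "x \<in> F \<Longrightarrow> \<sigma> (- x) = - \<sigma> x"
  using G_add[OF \<sigma>, of x "- x"] G_0 by (simp add: F_intros eq_neg_iff_add_eq_0 add.commute)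

lemma G_diff: "x \<in> F \<Longrightarrow> y \<in> F \<Longrightarrow> \<sigma> (x - y) = \<sigma> x - \<sigma> y"
  using G_add[OF \<sigma>, of x "- y"] G_minus[of y] by (simp add: F_intros)

lemma G_power: "x \<in> F \<Longrightarrow> \<sigma> (x ^ n) = \<sigma> x ^ n"
  by (induction n) (auto simp: G_1 G_mult[OF \<sigma>] F_intros)

lemma G_sum: "(\<And>i. i \<in> S \<Longrightarrow> f i \<in> F) \<Longrightarrow> \<sigma> (sum f S) = (\<Sum>i\<in>S. \<sigma> (f i))"
  by (induction S rule: infinite_finite_induct) (auto simp: G_0 G_add[OF \<sigma>] F_intros)

lemma G_prod: "(\<And>i. i \<in> S \<Longrightarrow> f i \<in> F) \<Longrightarrow> \<sigma> (prod f S) = (\<Prod>i\<in>S. \<sigma> (f i))"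
  by (induction S rule: infinite_finite_induct) (auto simp: G_1 G_mult[OF \<sigma>] F_intros)

lemma G_inverse: "x \<in> F \<Longrightarrow> \<sigma> (inverse x) = inverse (\<sigma> x)"
proof (cases "x = 0")
  case False
  assume x: "x \<in> F"
  then have "\<sigma> x * \<sigma> (inverse x) = 1"
    using G_mult[OF \<sigma>, of x "inverse x"] False G_1 by (simp add: F_intros)
  then show ?thesis by (metis inverse_unique)
qed (simp add: G_0)

lemma G_divide: "x \<in> F \<Longrightarrow> y \<in> F \<Longrightarrow> \<sigma> (x / y) = \<sigma> x / \<sigma> y"
  using G_mult[OF \<sigma>, of x "inverse y"] G_inverse[of y] F_inverse[of y] by (simp add: divide_inverse)

lemma G_eq_0_iff: "x \<in> F \<Longrightarrow> \<sigma> x = 0 \<longleftrightarrow> x = 0"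
  using G_mult[OF \<sigma>, of x "inverse x"] F_inverse[of x] G_0 G_1 by (cases "x = 0") auto

lemma inj_on_G: "inj_on \<sigma> F"
proof (rule inj_onI)
  fix x y assume "x \<in> F" "y \<in> F" "\<sigma> x = \<sigma> y"
  then show "x = y" using G_eq_0_iff[of "x - y"] G_diff[of x y] by (simp add: F_intros)
qed

lemma G_power_int: "x \<in> F \<Longrightarrow> \<sigma> (x powi k) = \<sigma> x powi k"
  by (simp add: power_int_def G_power G_inverse F_intros)

text \<open>Elements of \<open>A\<close> are integral over \<open>Z\<close>. An integral equation is
  preserved by \<sigma>, which fixes \<open>Z\<close>, and a valuation ring is integrally
  closed.\<close>

lemma G_A:
  assumes "x \<in> A" "x \<in> F"
  shows "\<sigma> x \<in> A"
proof -
  obtain r s where s: "\<And>i. s i \<in> Z" "x ^ r = (\<Sum>i<r. s i * x ^ i)"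
    using integral_over_Z[OF assms(1)] by blast
  have sF: "s i \<in> F" for i using s(1) Z_F by blast
  have "\<sigma> x ^ r = \<sigma> (\<Sum>i<r. s i * x ^ i)"
    using s(2) by (simp add: G_power[OF assms(2), symmetric])
  also have "\<dots> = (\<Sum>i<r. \<sigma> (s i * x ^ i))"
    by (intro G_sum F_intros sF assms)
  also have "\<dots> = (\<Sum>i<r. s i * \<sigma> x ^ i)"
    by (simp add: G_mult[OF \<sigma>] G_power F_intros sF assms G_Z[OF \<sigma>] s)
  finally show ?thesis by (rule integral_mem_A[rotated]) (use s(1) Z_subset in blast)
qed

lemma G_U: "x \<in> U \<Longrightarrow> x \<in> F \<Longrightarrow> \<sigma> x \<in> U"
  using G_A[of x] G_A[of "inverse x"] F_inverse[of x] G_eq_0_iff[of x] G_inverse[of x]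
  by (simp add: U_def)

text \<open>As \<sigma> fixes \<open>p\<close> and preserves units, the same \<open>n\<close> and
  \<open>k\<close> compute the value of \<open>\<sigma> x\<close>.\<close>

lemma v_G:
  assumes "x \<in> F" "x \<noteq> 0"
  shows "v (\<sigma> x) = v x"
proof -
  obtain n k where n: "n > 0" "x ^ n * P powi k \<in> U" "v x = - of_int k / of_nat n"
    using v_obtain[OF assms(2)] .
  have "\<sigma> (x ^ n * P powi k) \<in> U" using n assms by (intro G_U F_intros F_power_int)
  also have "\<sigma> (x ^ n * P powi k) = \<sigma> x ^ n * P powi k"
    by (simp add: G_mult[OF \<sigma>] G_power G_power_int G_of_nat F_intros F_power_int assms)
  finally show ?thesis using n v_eqI by simp
qed

lemma G_\<mm>: "x \<in> \<mm> \<Longrightarrow> x \<in> F \<Longrightarrow> \<sigma> x \<in> \<mm>"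
  using v_G[of x] by (cases "x = 0") (simp_all add: \<mm>_iff_v G_0)

end

section \<open>Orbits under the Galois group\<close>

definition orbit :: "'a \<Rightarrow> 'a set" where
  "orbit x = (\<lambda>\<sigma>. \<sigma> x) ` G"

lemma orbit_F: "x \<in> F \<Longrightarrow> orbit x \<subseteq> F"
  by (auto simp: orbit_def G_F)

lemma mem_orbit: "x \<in> F \<Longrightarrow> x \<in> orbit x"
  using G_id unfolding orbit_def by (metis image_eqI)

lemma finite_orbit:
  assumes x: "x \<in> F"
  shows "finite (orbit x)"
proof -
  obtain f where f: "f \<noteq> 0" "\<And>i. coeff f i \<in> Z" "poly f x = 0"
    using algebraic by blast
  have fF: "coeff f i \<in> F" for i using f(2) Z_F by blast
  have "poly f (\<sigma> x) = 0" if \<sigma>: "\<sigma> \<in> G" for \<sigma>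
  proof -
    have "poly f (\<sigma> x) = \<sigma> (poly f x)"
      unfolding poly_altdef
      by (subst G_sum[OF \<sigma>])
        (simp_all add: G_mult[OF \<sigma>] G_power[OF \<sigma>] F_intros fF x G_Z[OF \<sigma> f(2)])
    then show ?thesis using f(3) G_0[OF \<sigma>] by simp
  qed
  then have "orbit x \<subseteq> {y. poly f y = 0}" by (auto simp: orbit_def)
  then show ?thesis using poly_roots_finite[OF f(1)] finite_subset by blast
qed

text \<open>An injective map of a finite set into itself is onto; this takes the place of inverses
  in \<open>G\<close>.\<close>

lemma image_orbit:
  assumes \<sigma>: "\<sigma> \<in> G" and x: "x \<in> F"
  shows "\<sigma> ` orbit x = orbit x"
proof (rule endo_inj_surj[OF finite_orbit[OF x]])
  show "inj_on \<sigma> (orbit x)"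
    using inj_on_G[OF \<sigma>] orbit_F[OF x] inj_on_subset by blast
  show "\<sigma> ` orbit x \<subseteq> orbit x"
  proof
    fix y assume "y \<in> \<sigma> ` orbit x"
    then obtain \<tau> where \<tau>: "\<tau> \<in> G" "y = \<sigma> (\<tau> x)" by (auto simp: orbit_def)
    then obtain \<rho> where "\<rho> \<in> G" "\<rho> x = \<sigma> (\<tau> x)" using G_comp[OF \<sigma> \<tau>(1)] x by blast
    then show "y \<in> orbit x" using \<tau>(2) unfolding orbit_def by (metis image_eqI)
  qed
qed

text \<open>Each \<sigma> permutes the orbit, hence its subsets of size \<open>j\<close>, so the
  symmetric function is fixed by \<open>G\<close>.\<close>

lemma esym_orbit:
  assumes x: "x \<in> F"
  shows "\<exists>a\<in>Z. \<exists>b\<in>Z. b \<noteq> 0 \<and> esym (orbit x) j = a / b"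
proof (rule G_fixed)
  show "esym (orbit x) j \<in> F"
    unfolding esym_def using orbit_F[OF x] by (intro F_intros) auto
  fix \<sigma> assume \<sigma>: "\<sigma> \<in> G"
  let ?T = "{T. T \<subseteq> orbit x \<and> card T = j}"
  have inj: "inj_on \<sigma> (orbit x)"
    using inj_on_G[OF \<sigma>] orbit_F[OF x] inj_on_subset by blast
  have "\<sigma> (esym (orbit x) j) = (\<Sum>T\<in>?T. \<sigma> (\<Prod>T))"
    unfolding esym_def using orbit_F[OF x] by (intro G_sum[OF \<sigma>] F_intros) auto
  also have "\<dots> = (\<Sum>T\<in>?T. \<Prod>(\<sigma> ` T))"
  proof (intro sum.cong refl)
    fix T assume T: "T \<in> ?T"
    have "\<sigma> (\<Prod>T) = (\<Prod>y\<in>T. \<sigma> y)" using T orbit_F[OF x] by (intro G_prod[OF \<sigma>]) auto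
    also have "\<dots> = \<Prod>(\<sigma> ` T)"
      using T inj_on_subset[OF inj, of T] by (subst prod.reindex) auto
    finally show "\<sigma> (\<Prod>T) = \<Prod>(\<sigma> ` T)" .
  qed
  also have "\<dots> = (\<Sum>T\<in>(`) \<sigma> ` ?T. \<Prod>T)"
    by (subst sum.reindex[OF inj_on_subset[OF inj_on_image_Pow[OF inj]]]) auto
  also have "(`) \<sigma> ` ?T = ?T"
  proof (rule endo_inj_surj)
    show "finite ?T" using finite_orbit[OF x] by simp
    show "inj_on ((`) \<sigma>) ?T" using inj_on_image_Pow[OF inj] by (rule inj_on_subset) auto
    show "(`) \<sigma> ` ?T \<subseteq> ?T"
    proof
      fix T' assume "T' \<in> (`) \<sigma> ` ?T"
      then obtain T where T: "T' = \<sigma> ` T" "T \<subseteq> orbit x" "card T = j" by blast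
      then show "T' \<in> ?T"
        using image_orbit[OF \<sigma> x] card_image[OF inj_on_subset[OF inj T(2)]] by auto
    qed
  qed
  finally show "\<sigma> (esym (orbit x) j) = esym (orbit x) j" by (simp add: esym_def)
qed

end

section \<open>Frobenius lifts in abelian extensions\<close>

context galois_valued_extension
begin

lemma orbit_A: "x \<in> A \<Longrightarrow> x \<in> F \<Longrightarrow> orbit x \<subseteq> A"
  by (auto simp: orbit_def G_A)

lemma esym_orbit_Z:
  assumes "x \<in> A" "x \<in> F"
  shows "esym (orbit x) j \<in> Z"
proof -
  obtain a b where ab: "a \<in> Z" "b \<in> Z" "b \<noteq> 0" "esym (orbit x) j = a / b"
    using esym_orbit[OF assms(2)] by blast
  have "esym (orbit x) j \<in> A"
    unfolding esym_def using orbit_A[OF assms] by (intro A_intros) auto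
  then show ?thesis using fraction_mem_Z[of a b] ab by simp
qed

text \<open>\<open>y\<close> is a root of the product of \<open>t - x\<close> over its conjugates
  \<open>x\<close>. The coefficients lie in \<open>Z\<close>, so they equal their
  \<open>p\<close>-th powers modulo \<open>p\<close>; hence \<open>y ^ p\<close> is a root modulo
  \<mm> and is congruent to a conjugate of \<open>y\<close>.\<close>

lemma exists_frobenius:
  assumes y: "y \<in> A" "y \<in> F"
  shows "\<exists>\<tau>\<in>G. \<tau> y - y ^ p \<in> \<mm>"
proof -
  define N where "N = card (orbit y)"
  define c where "c = (\<lambda>j. (- 1) ^ j * esym (orbit y) j)"
  have cZ: "c j \<in> Z" for j unfolding c_def by (intro Z_intros esym_orbit_Z y)
  then have cA: "c j \<in> A" for j using Z_subset by blast
  have expand: "(\<Prod>x\<in>orbit y. t - x) = (\<Sum>j\<le>N. c j * t ^ (N - j))" for t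
    unfolding N_def c_def by (rule prod_diff_esym[OF finite_orbit[OF y(2)]])
  have "(\<Sum>j\<le>N. c j * y ^ (N - j)) = 0"
    unfolding expand[symmetric] using finite_orbit[OF y(2)] mem_orbit[OF y(2)]
    by (intro prod_zero) auto
  moreover have "(\<Sum>j\<le>N. c j * y ^ (N - j)) ^ p - (\<Sum>j\<le>N. (c j * y ^ (N - j)) ^ p) \<in> \<mm>"
    by (intro freshman_dream_sum A_intros cA y) auto
  ultimately have 1: "(\<Sum>j\<le>N. (c j * y ^ (N - j)) ^ p) \<in> \<mm>"
    using \<mm>_minus prime_gt_0_nat[OF prime_p] by (fastforce simp: power_0_left)
  have "(\<Sum>j\<le>N. c j * (y ^ p) ^ (N - j)) - (\<Sum>j\<le>N. (c j * y ^ (N - j)) ^ p)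
      = (\<Sum>j\<le>N. (c j - c j ^ p) * (y ^ p) ^ (N - j))"
    by (simp add: sum_subtractf[symmetric] algebra_simps power_mult_distrib power_mult[symmetric])
  also have "\<dots> \<in> \<mm>"
  proof (intro \<mm>_sum \<mm>_mult' A_intros y)
    fix j
    obtain z where "z \<in> Z" "c j ^ p - c j = P * z" using residue_field[OF cZ[of j]] by blast
    then have "c j ^ p - c j \<in> \<mm>" using Z_subset by (auto intro!: \<mm>_mult' P_\<mm>)
    then show "c j - c j ^ p \<in> \<mm>" by (rule cong_sym)
  qed
  finally have "(\<Sum>j\<le>N. c j * (y ^ p) ^ (N - j)) \<in> \<mm>"
    using 1 \<mm>_add by fastforce
  then have "(\<Prod>x\<in>orbit y. y ^ p - x) \<in> \<mm>" by (simp add: expand)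
  then obtain x where "x \<in> orbit y" "y ^ p - x \<in> \<mm>"
    using \<mm>_prime_prod[OF finite_orbit[OF y(2)], of "\<lambda>x. y ^ p - x"] orbit_A[OF y] y
    by (auto intro: A_intros)
  then show ?thesis using cong_sym by (auto simp: orbit_def)
qed

text \<open>If \<open>N = p ^ k * n\<close> is the size of the orbit and \<open>p\<close> does not divide \<open>n\<close>, then the
  elementary symmetric function of degree \<open>p ^ k\<close> is congruent to \<open>N choose p ^ k\<close>, a unit, times
  \<open>u ^ (p ^ k)\<close>.\<close>

lemma v_times_prime_power_Ints:
  assumes u: "u \<in> F" "u \<noteq> 0" and cong: "\<And>\<sigma>. \<sigma> \<in> G \<Longrightarrow> \<sigma> u / u - 1 \<in> \<mm>"
  shows "\<exists>k. of_nat (p ^ k) * v u \<in> \<int>"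
proof -
  define N where "N = card (orbit u)"
  have fin: "finite (orbit u)" by (rule finite_orbit[OF u(1)])
  then have N: "N > 0" using mem_orbit[OF u(1)] by (auto simp: N_def card_gt_0_iff)
  define k where "k = multiplicity p N"
  have "\<not> is_unit p" using prime_p by auto
  then obtain n where n: "N = p ^ k * n" "\<not> p dvd n"
    using multiplicity_decompose'[of N p] N unfolding k_def by auto
  have "n > 0" using n N by (cases n) auto
  \<comment> \<open>The binomial coefficient known from Wielandt's proof of Sylow's theorem:
    \<open>p\<close> divides it exactly as often as \<open>n\<close>.\<close>
  have "multiplicity p (N choose p ^ k) = multiplicity p n"
    unfolding n(1) by (rule const_p_fac[OF \<open>n > 0\<close> prime_p])
  also have "\<dots> = 0" using n(2) by (rule not_dvd_imp_multiplicity_0)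
  finally have mult: "multiplicity p (N choose p ^ k) = 0" .
  have "p ^ k \<le> N" using n \<open>n > 0\<close> by simp
  then have "N choose p ^ k \<noteq> 0" by simp
  then have "\<not> p dvd N choose p ^ k"
    using mult \<open>\<not> is_unit p\<close> by (simp add: multiplicity_eq_zero_iff)
  then have "coprime (N choose p ^ k) p"
    using prime_p by (metis coprime_commute prime_imp_coprime)
  then have binom: "of_nat (N choose p ^ k) \<in> U"
    using of_int_U[of "int (N choose p ^ k)"] by simp
  let ?T = "{T. T \<subseteq> orbit u \<and> card T = p ^ k}"
  \<comment> \<open>There are \<open>N choose p ^ k\<close> subsets, and for each of them the
    product of the \<open>x / u\<close> is congruent to \<open>1\<close>.\<close>
  have "esym (orbit u) (p ^ k) / u ^ (p ^ k) - of_nat (N choose p ^ k)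
      = (\<Sum>T\<in>?T. (\<Prod>x\<in>T. x / u) - 1)"
  proof -
    have "(\<Prod>x\<in>T. x / u) = \<Prod>T / u ^ (p ^ k)" if "T \<in> ?T" for T
      using that by (simp add: prod_dividef)
    moreover have "card ?T = N choose p ^ k"
      unfolding N_def by (rule n_subsets[OF fin])
    ultimately show ?thesis
      by (simp add: esym_def sum_subtractf sum_divide_distrib)
  qed
  also have "\<dots> \<in> \<mm>"
    by (intro \<mm>_sum cong_prod_1) (use cong in \<open>auto simp: orbit_def\<close>)
  finally have "esym (orbit u) (p ^ k) / u ^ (p ^ k) \<in> U"
    using binom by (rule mem_U_cong)
  then have e: "esym (orbit u) (p ^ k) \<noteq> 0" "v (esym (orbit u) (p ^ k) / u ^ (p ^ k)) = 0"
    using U_iff by auto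
  then have "of_nat (p ^ k) * v u = v (esym (orbit u) (p ^ k))"
    using u(2) by (simp add: v_divide v_power)
  moreover obtain a b where "a \<in> Z" "b \<in> Z" "b \<noteq> 0" "esym (orbit u) (p ^ k) = a / b"
    using esym_orbit[OF u(1)] by blast
  ultimately show ?thesis using e(1) v_fraction[of a b] by metis
qed

text \<open>If \<open>p = 3 * s + 2\<close> and \<open>c = \<sigma> u / u\<close>, then the corresponding quotient for \<open>twist s \<tau> u\<close> is
  \<open>c ^ p / \<tau> c\<close>, which is congruent to \<open>1\<close> as soon as \<open>\<tau>\<close> acts on the class of \<open>c\<close> as Frobenius.
  This is where the commutativity of the Galois group enters.\<close>

definition twist :: "nat \<Rightarrow> ('a \<Rightarrow> 'a) \<Rightarrow> 'a \<Rightarrow> 'a" where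
  "twist s \<tau> u = u ^ 2 * (u ^ 3 / P) ^ s / \<tau> u"

text \<open>The twist is \<open>u ^ (3 * s + 2) / \<tau> u\<close> divided by \<open>P ^ s\<close>.
  If \<open>v u = 1 / 3\<close>, then \<open>u ^ 3 / P\<close> is a unit, which leaves the value
  \<open>2 / 3 - 1 / 3\<close>. The formula for the cube gives a number congruent to
  \<open>1\<close> if \<tau> acts on \<open>u ^ 3 / P\<close> as Frobenius and
  \<open>3 * s + 2 = p\<close>.\<close>

lemma
  assumes u: "u \<in> F" "u \<noteq> 0" and \<tau>: "\<tau> \<in> G"
  shows twist_F: "twist s \<tau> u \<in> F" and twist_nonzero: "twist s \<tau> u \<noteq> 0"
    and v_twist: "v u = 1 / 3 \<Longrightarrow> v (twist s \<tau> u) = 1 / 3"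
    and twist_cube: "twist s \<tau> u ^ 3 / P = (u ^ 3 / P) ^ (3 * s + 2) / \<tau> (u ^ 3 / P)"
    and twist_quotient: "\<sigma> \<in> G \<Longrightarrow> \<sigma> (twist s \<tau> u) / twist s \<tau> u
      = (\<sigma> u / u) ^ (3 * s + 2) / \<tau> (\<sigma> u / u)"
proof -
  note FI = F_intros G_F[OF \<tau>] u
  have \<tau>u: "\<tau> u \<noteq> 0" using G_eq_0_iff[OF \<tau> u(1)] u(2) by simp
  show "twist s \<tau> u \<in> F" unfolding twist_def by (intro FI)
  show "twist s \<tau> u \<noteq> 0" using u \<tau>u P_nonzero by (simp add: twist_def)
  show "v (twist s \<tau> u) = 1 / 3" if "v u = 1 / 3"
    using u \<tau>u P_nonzero that
    by (simp add: twist_def v_divide v_mult v_power v_P v_G[OF \<tau>])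
  have "\<tau> (u ^ 3 / P) = \<tau> u ^ 3 / P"
    using u by (simp add: G_divide[OF \<tau>] G_power[OF \<tau>] G_of_nat[OF \<tau>] FI)
  then show "twist s \<tau> u ^ 3 / P = (u ^ 3 / P) ^ (3 * s + 2) / \<tau> (u ^ 3 / P)"
    using \<tau>u P_nonzero by (simp add: twist_def field_simps power_add power_mult power2_eq_square
      power3_eq_cube power_mult_distrib)
  show "\<sigma> (twist s \<tau> u) / twist s \<tau> u = (\<sigma> u / u) ^ (3 * s + 2) / \<tau> (\<sigma> u / u)"
    if \<sigma>: "\<sigma> \<in> G"
  proof -
    have \<sigma>u: "\<sigma> u \<noteq> 0" using G_eq_0_iff[OF \<sigma> u(1)] u(2) by simp
    have \<tau>\<sigma>u: "\<tau> (\<sigma> u) \<noteq> 0" using G_eq_0_iff[OF \<tau> G_F[OF \<sigma> u(1)]] \<sigma>u by simp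
    have 1: "\<sigma> (twist s \<tau> u) = \<sigma> u ^ 2 * (\<sigma> u ^ 3 / P) ^ s / \<tau> (\<sigma> u)"
      unfolding twist_def using G_commute[OF \<sigma> \<tau> u(1)]
      by (simp add: G_divide[OF \<sigma>] G_mult[OF \<sigma>] G_power[OF \<sigma>] G_of_nat[OF \<sigma>] FI)
    have 2: "\<tau> (\<sigma> u / u) = \<tau> (\<sigma> u) / \<tau> u"
      by (intro G_divide[OF \<tau>] G_F[OF \<sigma>] u)
    show ?thesis
      unfolding 1 2 unfolding twist_def
      using u(2) \<tau>u \<sigma>u \<tau>\<sigma>u P_nonzero
      by (simp add: field_simps power_add power_mult power2_eq_square
        power3_eq_cube power_mult_distrib)
  qed
qed

text \<open>A first twist, by a Frobenius at \<open>w = u\<^sup>3 / p\<close>, makes \<open>w\<close> congruent to \<open>1\<close>; then every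
  quotient \<open>c \<sigma>\<close> is a cube root of unity modulo \<open>\<mm>\<close>, hence a power of a single \<open>z\<close>, and a second
  twist, by a Frobenius at \<open>z\<close>, makes all quotients congruent to \<open>1\<close>.\<close>

lemma v_neq_one_third:
  assumes p: "p = 3 * s + 2" and u: "u \<in> F" "u \<noteq> 0"
  shows "v u \<noteq> 1 / 3"
proof
  assume vu: "v u = 1 / 3"
  have cube_U: "x ^ 3 / P \<in> U" if "x \<noteq> 0" "v x = 1 / 3" for x
    using that P_nonzero by (simp add: U_iff v_divide v_power v_P)
  have quotient_U: "\<sigma> x / x \<in> U" if "\<sigma> \<in> G" "x \<in> F" "x \<noteq> 0" for \<sigma> x
    using that by (simp add: U_iff v_divide v_G G_eq_0_iff)
  let ?w = "u ^ 3 / P"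
  have w: "?w \<in> U" "?w \<in> F" by (intro cube_U u vu) (intro F_intros u)
  obtain \<tau> where \<tau>: "\<tau> \<in> G" "\<tau> ?w - ?w ^ p \<in> \<mm>"
    using exists_frobenius[OF U_subset[OF w(1)] w(2)] by blast
  define u1 where "u1 = twist s \<tau> u"
  have u1: "u1 \<in> F" "u1 \<noteq> 0" "v u1 = 1 / 3"
    unfolding u1_def by (intro twist_F twist_nonzero v_twist u \<tau>(1) vu)+
  have cube_cong: "u1 ^ 3 / P - 1 \<in> \<mm>"
    unfolding u1_def twist_cube[OF u \<tau>(1)] p[symmetric]
    by (intro cong_divide_1 cong_sym[OF \<tau>(2)] G_U[OF \<tau>(1)] w)
  define c where "c = (\<lambda>\<sigma>. \<sigma> u1 / u1)"
  have c: "c \<sigma> \<in> U" "c \<sigma> \<in> A" "c \<sigma> \<in> F" if "\<sigma> \<in> G" for \<sigma>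
    using quotient_U[OF that u1(1,2)] U_subset unfolding c_def
    by (auto intro!: F_intros G_F[OF that] u1)
  have c_cube: "c \<sigma> ^ 3 - 1 \<in> \<mm>" if \<sigma>: "\<sigma> \<in> G" for \<sigma>
  proof -
    \<comment> \<open>Both numerator and denominator are congruent to \<open>1\<close>, by
      \<open>cube_cong\<close>.\<close>
    have "c \<sigma> ^ 3 = \<sigma> (u1 ^ 3 / P) / (u1 ^ 3 / P)"
      using u1 P_nonzero
      by (simp add: c_def G_divide[OF \<sigma>] G_power[OF \<sigma>] G_of_nat[OF \<sigma>] F_intros field_simps)
    moreover have "\<sigma> (u1 ^ 3 / P) - u1 ^ 3 / P \<in> \<mm>"
    proof (rule cong_trans)
      have "\<sigma> (u1 ^ 3 / P - 1) \<in> \<mm>" by (intro G_\<mm>[OF \<sigma>] cube_cong F_intros u1)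
      then show "\<sigma> (u1 ^ 3 / P) - 1 \<in> \<mm>"
        by (simp add: G_diff[OF \<sigma>] G_1[OF \<sigma>] F_intros u1)
      show "1 - u1 ^ 3 / P \<in> \<mm>" by (rule cong_sym[OF cube_cong])
    qed
    ultimately show ?thesis using cong_divide_1[OF _ cube_U[OF u1(2,3)]] by (metis (no_types))
  qed
  have "\<exists>z\<in>c ` G. \<forall>\<sigma>\<in>G. \<exists>i::nat. c \<sigma> - z ^ i \<in> \<mm>"
  proof (cases "\<forall>\<sigma>\<in>G. c \<sigma> - 1 \<in> \<mm>")
    case True
    \<comment> \<open>Any quotient serves as \<open>z\<close> here, with exponent
      \<open>0\<close>.\<close>
    then show ?thesis using G_id by (auto intro!: bexI exI[of _ 0])
  next
    case False
    then obtain \<rho> where \<rho>: "\<rho> \<in> G" "c \<rho> - 1 \<notin> \<mm>" by blast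
    let ?z = "c \<rho>"
    have "(?z - 1) * (?z ^ 2 + ?z + 1) \<in> \<mm>"
      using c_cube[OF \<rho>(1)] by (simp add: algebra_simps power2_eq_square power3_eq_cube)
    then have z: "?z ^ 2 + ?z + 1 \<in> \<mm>"
      using \<mm>_prime \<rho> c(2)[OF \<rho>(1)] by (meson A_intros)
    have "\<exists>i::nat. c \<sigma> - ?z ^ i \<in> \<mm>" if \<sigma>: "\<sigma> \<in> G" for \<sigma>
    proof -
      let ?x = "c \<sigma>"
      \<comment> \<open>Modulo \<open>z ^ 2 + z + 1\<close> the cube roots of unity are
        \<open>1\<close>, \<open>z\<close> and \<open>z ^ 2\<close>, so this product reduces to
        \<open>x ^ 3 - 1\<close>. As \<mm> is prime, \<open>x\<close> is congruent to one of the
        three.\<close>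
      have "(?x - 1) * ((?x - ?z) * (?x - ?z ^ 2))
          = (?x ^ 3 - 1) + (?z ^ 2 + ?z + 1) * (- (?x ^ 2) + ?z * ?x - ?z + 1)"
        by (simp add: algebra_simps power2_eq_square power3_eq_cube)
      also have "\<dots> \<in> \<mm>"
        by (intro \<mm>_add \<mm>_mult' z c_cube \<sigma> A_intros c \<rho>)
      finally have *: "(?x - 1) * ((?x - ?z) * (?x - ?z ^ 2)) \<in> \<mm>" .
      have x: "?x \<in> A" and z: "?z \<in> A" by (intro c \<sigma> \<rho>)+
      have "?x - 1 \<in> \<mm> \<or> (?x - ?z) * (?x - ?z ^ 2) \<in> \<mm>"
        by (rule \<mm>_prime[OF *]) (intro A_intros x z)+
      moreover have "?x - ?z \<in> \<mm> \<or> ?x - ?z ^ 2 \<in> \<mm>" if "(?x - ?z) * (?x - ?z ^ 2) \<in> \<mm>"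
        by (rule \<mm>_prime[OF that]) (intro A_intros x z)+
      ultimately have "?x - 1 \<in> \<mm> \<or> ?x - ?z \<in> \<mm> \<or> ?x - ?z ^ 2 \<in> \<mm>" by blast
      then show ?thesis by (metis power_0 power_one_right)
    qed
    then show ?thesis using \<rho>(1) by blast
  qed
  then obtain \<rho> where \<rho>: "\<rho> \<in> G" and pow: "\<And>\<sigma>. \<sigma> \<in> G \<Longrightarrow> \<exists>i::nat. c \<sigma> - c \<rho> ^ i \<in> \<mm>"
    by blast
  let ?z = "c \<rho>"
  note z = c[OF \<rho>]
  obtain \<tau>' where \<tau>': "\<tau>' \<in> G" "\<tau>' ?z - ?z ^ p \<in> \<mm>"
    using exists_frobenius[OF z(2,3)] by blast
  define u2 where "u2 = twist s \<tau>' u1"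
  have u2: "u2 \<in> F" "u2 \<noteq> 0" "v u2 = 1 / 3"
    unfolding u2_def by (intro twist_F twist_nonzero v_twist u1 \<tau>'(1))+
  have "\<sigma> u2 / u2 - 1 \<in> \<mm>" if \<sigma>: "\<sigma> \<in> G" for \<sigma>
  proof -
    obtain i where i: "c \<sigma> - ?z ^ i \<in> \<mm>" using pow[OF \<sigma>] by blast
    \<comment> \<open>Acting as \<open>p\<close>-th power on the class of \<open>z\<close>, the map
      \<open>\<tau>'\<close> does so on the powers of that class, hence on the class of
      \<open>c \<sigma>\<close>.\<close>
    have "\<tau>' (c \<sigma> - ?z ^ i) \<in> \<mm>" by (intro G_\<mm>[OF \<tau>'(1)] i F_intros c \<sigma> z)
    then have "\<tau>' (c \<sigma>) - \<tau>' ?z ^ i \<in> \<mm>"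
      by (simp add: G_diff[OF \<tau>'(1)] G_power[OF \<tau>'(1)] F_intros c \<sigma> z)
    moreover have "\<tau>' ?z ^ i - (?z ^ p) ^ i \<in> \<mm>"
      by (intro cong_power \<tau>' G_A[OF \<tau>'(1)] A_intros z)
    moreover have "(?z ^ p) ^ i = (?z ^ i) ^ p" by (simp add: power_mult[symmetric] mult.commute)
    moreover have "(?z ^ i) ^ p - c \<sigma> ^ p \<in> \<mm>"
      by (intro cong_power cong_sym[OF i] A_intros c \<sigma> z)
    ultimately have "\<tau>' (c \<sigma>) - c \<sigma> ^ p \<in> \<mm>" by (metis cong_trans)
    then have "c \<sigma> ^ p / \<tau>' (c \<sigma>) - 1 \<in> \<mm>"
      by (intro cong_divide_1 cong_sym[of "\<tau>' (c \<sigma>)"] G_U[OF \<tau>'(1)] c \<sigma>)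
    then show ?thesis
      unfolding u2_def twist_quotient[OF u1(1,2) \<tau>'(1) \<sigma>] p[symmetric] by (simp add: c_def)
  qed
  then obtain k where "of_nat (p ^ k) * v u2 \<in> \<int>"
    using v_times_prime_power_Ints[OF u2(1,2)] by blast
  \<comment> \<open>As \<open>v u2 = 1 / 3\<close>, the number \<open>p ^ k / 3\<close> is an
    integer, so \<open>3\<close> divides \<open>p\<close>, which is \<open>2\<close> modulo
    \<open>3\<close>.\<close>
  then obtain m where "rat_of_nat (p ^ k) / 3 = of_int m" using u2(3) by (auto elim: Ints_cases)
  then have "rat_of_int (int p ^ k) = of_int (3 * m)" by (simp add: field_simps)
  then have "int p ^ k = 3 * m" by (simp only: of_int_eq_iff)
  then have "3 dvd p ^ k" by (metis dvd_triv_left int_dvd_int_iff of_nat_numeral of_nat_power)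
  then have "3 dvd p" by (rule prime_dvd_power[rotated]) simp
  then show False using p by presburger
qed

end

section \<open>Denominators of values are prime to \<open>3\<close>\<close>

context galois_valued_extension
begin

text \<open>If the least denominator were \<open>3 * n'\<close>, then \<open>x ^ n'\<close> would
  have value \<open>m / 3\<close> with \<open>m\<close> prime to \<open>3\<close>. Multiplied by a
  power of \<open>p\<close>, after inversion if \<open>m\<close> is \<open>2\<close> modulo
  \<open>3\<close>, it would become an element of value \<open>1 / 3\<close>.\<close>

lemma v_denominator:
  assumes p: "p = 3 * s + 2" and x: "x \<in> F" "x \<noteq> 0"
  shows "\<exists>n::nat. \<not> 3 dvd n \<and> of_nat n * v x \<in> \<int>"
proof -
  define Q where "Q = (\<lambda>n::nat. n > 0 \<and> of_nat n * v x \<in> \<int>)"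
  obtain n k where "n > 0" "v x = - of_int k / of_nat n"
    using v_obtain[OF x(2)] by blast
  then have "Q n" by (simp add: Q_def)
  define n where "n = (LEAST n. Q n)"
  have n: "Q n" unfolding n_def using \<open>Q _\<close> by (rule LeastI)
  have "\<not> 3 dvd n"
  proof
    assume "3 dvd n"
    then obtain n' where n': "n = 3 * n'" by blast
    obtain m where m: "of_nat n * v x = of_int m" using n unfolding Q_def by (auto elim: Ints_cases)
    then have vm: "of_nat n' * v x = of_int m / 3" by (simp add: n')
    have "n' > 0" "n' < n" using n n' by (auto simp: Q_def)
    then have "\<not> Q n'" using not_less_Least[of n' Q] by (simp add: n_def)
    then have "of_int m / 3 \<notin> (\<int> :: rat set)"
      using vm \<open>n' > 0\<close> by (simp add: Q_def)
    then have "\<not> 3 dvd m" by auto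
    then have "m = 3 * (m div 3) + 1 \<or> m = 3 * (m div 3) + 2" by presburger
    then consider q where "m = 3 * q + 1" | q where "m = 3 * q + 2" by blast
    then show False
    proof cases
      case 1
      have "v (x ^ n' * P powi (- q)) = of_nat n' * v x - of_int q"
        using x P_nonzero by (simp add: v_mult v_power v_power_int v_P)
      also have "\<dots> = 1 / 3" using 1 by (simp add: vm add_divide_distrib)
      finally show False
        using v_neq_one_third[OF p _ _, of "x ^ n' * P powi (- q)"] x P_nonzero
        by (simp add: F_intros F_power_int)
    next
      case 2
      have "v (P powi (q + 1) / x ^ n') = of_int q + 1 - of_nat n' * v x"
        using x P_nonzero by (simp add: v_divide v_power v_power_int v_P)
      also have "\<dots> = 1 / 3" using 2 by (simp add: vm add_divide_distrib)
      finally show False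
        using v_neq_one_third[OF p _ _, of "P powi (q + 1) / x ^ n'"] x P_nonzero
        by (simp add: F_intros F_power_int)
    qed
  qed
  with n show ?thesis unfolding Q_def by blast
qed

end

text \<open>The valuations of the three terms are congruent to \<open>0, 1, 2\<close> modulo \<open>3\<close> in the local ring of the
  rationals at \<open>3\<close>, so no two of them can be equal.\<close>

lemma (in valued_extension) diagonal_cubic_no_zero:
  assumes \<alpha>: "\<And>i. i < 3 \<Longrightarrow> \<alpha> i \<in> U"
    and x: "\<And>i. i < 3 \<Longrightarrow> x i \<noteq> 0 \<Longrightarrow> \<exists>n::nat. \<not> 3 dvd n \<and> of_nat n * v (x i) \<in> \<int>"
    and sum: "(\<Sum>i<3. \<alpha> i * P ^ i * x i ^ 3) = 0" and i: "i < (3::nat)"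
  shows "x i = 0"
proof (rule ccontr)
  assume xi: "x i \<noteq> 0"
  \<comment> \<open>Zero coordinates are left out because \<open>v 0\<close> is arbitrary.\<close>
  define S where "S = {i. i < 3 \<and> x i \<noteq> 0}"
  define t where "t = (\<lambda>i. \<alpha> i * P ^ i * x i ^ 3)"
  have t: "t i \<noteq> 0" "v (t i) = of_nat i + 3 * v (x i)" if "i \<in> S" for i
    using that U_nonzero[OF \<alpha>, of i] P_nonzero v_U[OF \<alpha>, of i]
    by (auto simp: S_def t_def v_mult v_power v_P)
  have "(\<Sum>i\<in>S. t i) = (\<Sum>i<3. t i)"
    by (intro sum.mono_neutral_left) (auto simp: S_def t_def)
  then have "(\<Sum>i\<in>S. t i) = 0" using sum by (simp add: t_def)
  moreover have "finite S" "S \<noteq> {}" using i xi by (auto simp: S_def)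
  ultimately obtain j k where jk: "j \<in> S" "k \<in> S" "j \<noteq> k" "t j / t k \<in> U"
    using exists_tie[of S t] t(1) by blast
  have "v (t j) = v (t k)"
    using v_U[OF jk(4)] t(1)[OF jk(1)] t(1)[OF jk(2)] by (simp add: v_divide)
  then have eq: "rat_of_int (int j - int k) = 3 * (v (x k) - v (x j))"
    using t(2)[OF jk(1)] t(2)[OF jk(2)] by simp
  obtain m b where m: "\<not> 3 dvd m" "of_nat m * v (x j) = of_int b"
    using x[of j] jk by (auto simp: S_def elim!: Ints_cases)
  obtain n c where n: "\<not> 3 dvd n" "of_nat n * v (x k) = of_int c"
    using x[of k] jk by (auto simp: S_def elim!: Ints_cases)
  \<comment> \<open>Clearing denominators shows that \<open>3\<close> divides
    \<open>m * n * (j - k)\<close>, although \<open>m\<close> and \<open>n\<close> are prime to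
    \<open>3\<close> and \<open>j\<close>, \<open>k\<close> are distinct indices below
    \<open>3\<close>.\<close>
  have "rat_of_int (int m * int n * (int j - int k)) = of_nat m * of_nat n * rat_of_int (int j - int k)"
    by simp
  also have "\<dots> = 3 * (of_nat m * (of_nat n * v (x k)) - of_nat n * (of_nat m * v (x j)))"
    unfolding eq by (simp add: algebra_simps)
  also have "\<dots> = of_int (3 * (int m * c - int n * b))"
    unfolding m n by simp
  finally have "3 dvd int m * int n * (int j - int k)"
    by (simp only: of_int_eq_iff) simp
  moreover have "Factorial_Ring.prime (3::int)" by simp
  ultimately have "3 dvd int m \<or> 3 dvd int n \<or> 3 dvd int j - int k"
    by (simp only: prime_dvd_mult_iff) blast
  moreover have "\<not> 3 dvd int j - int k"
    using jk by (auto simp: S_def less_Suc_eq numeral_3_eq_3)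
  moreover have "3 dvd int l \<longleftrightarrow> 3 dvd l" for l :: nat by presburger
  ultimately show False using m n by blast
qed

section \<open>The p-adic integers\<close>

lemma Rep_padic_int_compat: "\<forall>n. Rep_padic_int x (Suc n) mod int CARD('p) ^ n = Rep_padic_int (x :: 'p::prime_card padic_int) n"
  using Rep_padic_int[of x] by simp

lemma Rep_padic_int_mod: "Rep_padic_int x n mod int CARD('p) ^ n = Rep_padic_int (x :: 'p::prime_card padic_int) n"
  by (rule compat_mod[OF Rep_padic_int_compat])

lemma Rep_padic_int_mod_le:
  "m \<le> n \<Longrightarrow> Rep_padic_int x n mod int CARD('p) ^ m = Rep_padic_int (x :: 'p::prime_card padic_int) m"
  by (rule compat_mod_le[OF Rep_padic_int_compat])

lemma Rep_padic_int_of_nat: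
  "Rep_padic_int (of_nat k :: 'p::prime_card padic_int) n = int k mod int CARD('p) ^ n"
proof (induction k)
  case (Suc k)
  show ?case
    unfolding of_nat_Suc plus_padic_int.rep_eq one_padic_int.rep_eq Suc.IH by (rule mod_add_eq)
qed (simp add: zero_padic_int.rep_eq)

lemma Rep_padic_int_of_int:
  "Rep_padic_int (of_int k :: 'p::prime_card padic_int) n = k mod int CARD('p) ^ n"
  by (cases k rule: int_cases2)
    (simp_all add: uminus_padic_int.rep_eq Rep_padic_int_of_nat mod_simps)

lemma Rep_padic_int_power:
  "Rep_padic_int (x ^ k) n = Rep_padic_int (x :: 'p::prime_card padic_int) n ^ k mod int CARD('p) ^ n"
  by (induction k) (simp_all add: one_padic_int.rep_eq times_padic_int.rep_eq mod_simps)

lemma compat_shift: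
  assumes f: "\<forall>n. f (Suc n) mod (q :: int) ^ n = f n" and q: "q > 0"
  shows "f (Suc n + N) div q ^ N mod q ^ n = f (n + N) div q ^ N"
proof -
  have "f (Suc (n + N)) mod q ^ (N + n) = q ^ N * (f (Suc (n + N)) div q ^ N mod q ^ n) + f (Suc (n + N)) mod q ^ N"
    using q unfolding power_add by (intro zmod_zmult2_eq) simp
  then show ?thesis using f q by (simp add: add.commute)
qed

text \<open>Drops the \<open>N\<close> lowest digits, which is division by \<open>p ^ N\<close> if
  they vanish. The index is \<open>n + N\<close> because the quotient modulo \<open>p ^ n\<close>
  depends on the numerator modulo \<open>p ^ (n + N)\<close>.\<close>

lift_definition padic_shift :: "nat \<Rightarrow> 'p::prime_card padic_int \<Rightarrow> 'p padic_int" is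
  "\<lambda>N f n. f (n + N) div int CARD('p) ^ N"
  using compat_shift card_pos by blast

lemma Rep_padic_int_eq_0_iff:
  fixes x :: "'p::prime_card padic_int"
  shows "Rep_padic_int x N = 0 \<longleftrightarrow> of_nat CARD('p) ^ N dvd x"
proof
  let ?q = "int CARD('p)"
  assume "Rep_padic_int x N = 0"
  then have x: "?q ^ N dvd Rep_padic_int x (n + N)" for n
    using Rep_padic_int_mod_le[of N "n + N" x] by auto
  have "of_nat (CARD('p) ^ N) * padic_shift N x = x"
  proof (rule Rep_padic_int_inject[THEN iffD1], rule ext)
    fix n
    have "Rep_padic_int (of_nat (CARD('p) ^ N) * padic_shift N x) n
        = (?q ^ N * (Rep_padic_int x (n + N) div ?q ^ N)) mod ?q ^ n"
      unfolding times_padic_int.rep_eq Rep_padic_int_of_nat padic_shift.rep_eq by (simp add: mod_simps)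
    also have "\<dots> = Rep_padic_int x n"
      using x[of n] Rep_padic_int_mod_le[of n "n + N" x] by simp
    finally show "Rep_padic_int (of_nat (CARD('p) ^ N) * padic_shift N x) n = Rep_padic_int x n" .
  qed
  then show "of_nat CARD('p) ^ N dvd x" by (metis dvd_triv_left of_nat_power)
next
  assume "of_nat CARD('p) ^ N dvd x"
  then obtain y where y: "x = of_nat (CARD('p) ^ N) * y" by (auto elim: dvdE)
  show "Rep_padic_int x N = 0"
    unfolding y times_padic_int.rep_eq Rep_padic_int_of_nat by simp
qed

lemma padic_int_eq_0:
  fixes x :: "'p::prime_card padic_int"
  assumes "\<And>N. of_nat CARD('p) ^ N dvd x"
  shows "x = 0"
  using assms unfolding Rep_padic_int_eq_0_iff[symmetric]
  by (intro Rep_padic_int_inject[THEN iffD1]) (simp add: zero_padic_int.rep_eq fun_eq_iff)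

text \<open>Terms with \<open>k \<ge> n\<close> vanish modulo \<open>p ^ n\<close>, so the limit can
  be given the \<open>n\<close>-th residue of the \<open>n\<close>-th partial sum.\<close>

lemma padic_int_complete:
  fixes a :: "nat \<Rightarrow> 'p::prime_card padic_int"
  shows "\<exists>s. \<forall>N. of_nat CARD('p) ^ N dvd s - (\<Sum>k<N. of_nat CARD('p) ^ k * a k)"
proof -
  let ?q = "int CARD('p)"
  define S where "S = (\<lambda>N. \<Sum>k<N. of_nat CARD('p) ^ k * a k)"
  define f where "f = (\<lambda>n. Rep_padic_int (S n) n)"
  have step: "Rep_padic_int (S (Suc n)) n = Rep_padic_int (S n) n" for n
  proof -
    have "Rep_padic_int (of_nat CARD('p) ^ n * a n) n = 0"
      unfolding Rep_padic_int_eq_0_iff by simp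
    then show ?thesis
      by (simp add: S_def plus_padic_int.rep_eq Rep_padic_int_mod)
  qed
  have "\<forall>n. f (Suc n) mod ?q ^ n = f n"
    using Rep_padic_int_compat[of "S (Suc _)"] step by (simp add: f_def)
  then have s: "Rep_padic_int (Abs_padic_int f :: 'p padic_int) = f"
    by (intro Abs_padic_int_inverse) simp
  have "Rep_padic_int (Abs_padic_int f - S N) N = 0" for N
    unfolding minus_padic_int.rep_eq s by (simp add: f_def)
  then show ?thesis unfolding Rep_padic_int_eq_0_iff S_def by blast
qed

text \<open>If \<open>a\<close> inverts \<open>u\<close> modulo \<open>p\<close>, then
  \<open>u * a = 1 - p * y\<close>, and \<open>1 - p * y\<close> is inverted by the geometric
  series.\<close>

lemma padic_int_unit:
  fixes u :: "'p::prime_card padic_int"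
  assumes "Rep_padic_int u 1 \<noteq> 0"
  shows "\<exists>w. u * w = 1"
proof -
  let ?q = "int CARD('p)" and ?P = "of_nat CARD('p) :: 'p padic_int"
  have "\<not> ?q dvd Rep_padic_int u 1"
    using assms Rep_padic_int_mod[of u 1] by auto
  then have "coprime ?q (Rep_padic_int u 1)"
    using prime_imp_coprime[OF prime_card_int] by blast
  then obtain a where a: "[Rep_padic_int u 1 * a = 1] (mod ?q)"
    using cong_solve_coprime_int coprime_commute by blast
  have "Rep_padic_int (1 - u * of_int a) 1 = (1 - Rep_padic_int u 1 * a) mod ?q"
    by (simp add: minus_padic_int.rep_eq times_padic_int.rep_eq one_padic_int.rep_eq
      Rep_padic_int_of_int mod_simps)
  also have "\<dots> = 0" using a by (metis cong_iff_dvd_diff cong_sym dvd_imp_mod_0)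
  finally have "?P ^ 1 dvd 1 - u * of_int a" unfolding Rep_padic_int_eq_0_iff .
  then obtain y where y: "1 - u * of_int a = ?P * y" by (auto elim: dvdE)
  obtain s where s: "\<And>N. ?P ^ N dvd s - (\<Sum>k<N. ?P ^ k * y ^ k)"
    using padic_int_complete[of "\<lambda>k. y ^ k"] by blast
  have "u * (of_int a * s) - 1 = 0"
  proof (rule padic_int_eq_0)
    fix N
    have "(1 - ?P * y) * (\<Sum>k<N. ?P ^ k * y ^ k) = 1 - ?P ^ N * y ^ N"
      using one_diff_power_eq[of "?P * y" N] by (simp add: power_mult_distrib)
    moreover have "u * of_int a = 1 - ?P * y" using y by (simp add: algebra_simps)
    then have "u * (of_int a * s) = (1 - ?P * y) * s" by (simp only: mult.assoc[symmetric])
    ultimately have "u * (of_int a * s) - 1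
        = (1 - ?P * y) * (s - (\<Sum>k<N. ?P ^ k * y ^ k)) - ?P ^ N * y ^ N"
      by (simp only: right_diff_distrib) simp
    then show "?P ^ N dvd u * (of_int a * s) - 1"
      using s[of N] by (simp add: dvd_diff)
  qed
  then show ?thesis by (intro exI[of _ "of_int a * s"]) simp
qed

text \<open>Only \<open>0\<close> is divisible by all powers of \<open>p\<close>. Once the largest
  power dividing \<open>x\<close> is removed, the residue modulo \<open>p\<close> is nonzero and
  \<open>padic_int_unit\<close> applies.\<close>

lemma padic_int_factorization:
  fixes x :: "'p::prime_card padic_int"
  assumes "x \<noteq> 0"
  shows "\<exists>k u w. x = of_nat CARD('p) ^ k * u \<and> u * w = 1"
proof -
  let ?P = "of_nat CARD('p) :: 'p padic_int"
  obtain N where N: "\<not> ?P ^ N dvd x" using assms padic_int_eq_0 by blast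
  define M where "M = (LEAST N. \<not> ?P ^ N dvd x)"
  have M: "\<not> ?P ^ M dvd x" unfolding M_def using N by (rule LeastI)
  then obtain k where k: "M = Suc k" by (cases M) auto
  have "?P ^ k dvd x" using not_less_Least[of k "\<lambda>N. \<not> ?P ^ N dvd x"] by (simp add: M_def[symmetric] k)
  then obtain u where u: "x = ?P ^ k * u" by (auto elim: dvdE)
  have "\<not> ?P ^ 1 dvd u"
  proof
    assume "?P ^ 1 dvd u"
    then have "?P ^ k * ?P dvd ?P ^ k * u" by (intro mult_dvd_mono) auto
    then show False using M u k by (simp add: mult.commute)
  qed
  then have "Rep_padic_int u 1 \<noteq> 0" unfolding Rep_padic_int_eq_0_iff .
  then show ?thesis using padic_int_unit u by blast
qed

text \<open>Fermat's little theorem for the residue of \<open>x\<close> modulo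
  \<open>p\<close>.\<close>

lemma padic_int_residue_field:
  fixes x :: "'p::prime_card padic_int"
  shows "of_nat CARD('p) dvd x ^ CARD('p) - x"
proof -
  define a where "a = nat (Rep_padic_int x 1)"
  have "Rep_padic_int x 1 \<ge> 0"
    using Rep_padic_int_mod[of x 1] card_pos[where 'p = 'p] by (metis power_one_right pos_mod_sign)
  then have a: "Rep_padic_int x 1 = int a" by (simp add: a_def)
  have "[a ^ CARD('p) = a] (mod CARD('p))"
  proof (cases "CARD('p) dvd a")
    case True
    then have "CARD('p) dvd a ^ CARD('p)" by (simp add: dvd_power_same dvd_trans[OF _ dvd_power])
    then show ?thesis using True by (simp add: cong_def)
  next
    case False
    have "[a ^ (CARD('p) - 1) * a = 1 * a] (mod CARD('p))"
      by (intro cong_mult fermat_theorem False prime_card) auto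
    moreover have "a ^ (CARD('p) - 1) * a = a ^ CARD('p)" by (simp flip: power_Suc2)
    ultimately show ?thesis by simp
  qed
  then have "[int a ^ CARD('p) = int a] (mod int CARD('p))"
    by (metis cong_int_iff of_nat_power)
  then have "Rep_padic_int (x ^ CARD('p) - x) 1 = 0"
    unfolding minus_padic_int.rep_eq Rep_padic_int_power a
    by (simp add: mod_simps cong_iff_dvd_diff)
  then show ?thesis unfolding Rep_padic_int_eq_0_iff by simp
qed

lemma padic_int_prime_not_unit: "of_nat CARD('p) * x \<noteq> (1 :: 'p::prime_card padic_int)"
proof
  assume "of_nat CARD('p) * x = (1 :: 'p padic_int)"
  then have "of_nat CARD('p) ^ 1 dvd (1 :: 'p padic_int)" by (metis dvd_triv_left power_one_right)
  then have "1 mod int CARD('p) = 0"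
    unfolding Rep_padic_int_eq_0_iff[symmetric] by (simp add: one_padic_int.rep_eq)
  then show False using prime_gt_1_nat[OF prime_card[where 'a = 'p]] by simp
qed

section \<open>The embedding of the \<open>p\<close>-adic integers into the algebraic
  closure\<close>

definition of_padic_int :: "'p::prime_card padic_int \<Rightarrow> 'p padic alg_closure" where
  "of_padic_int x = to_ac (Fract x 1)"

lemma of_padic_int_0: "of_padic_int 0 = 0"
  and of_padic_int_1: "of_padic_int 1 = 1"
  and of_padic_int_add: "of_padic_int (x + y) = of_padic_int x + of_padic_int y"
  and of_padic_int_mult: "of_padic_int (x * y) = of_padic_int x * of_padic_int y"
  and of_padic_int_minus: "of_padic_int (- x) = - of_padic_int x"
  and of_padic_int_eq_iff: "of_padic_int x = of_padic_int y \<longleftrightarrow> x = y"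
  by (simp_all add: of_padic_int_def Zero_fract_def[symmetric] One_fract_def[symmetric] eq_fract
    flip: to_ac_add to_ac_mult to_ac_minus)

lemma of_padic_int_diff: "of_padic_int (x - y) = of_padic_int x - of_padic_int y"
  using of_padic_int_add[of x "- y"] of_padic_int_minus[of y] by simp

lemma of_padic_int_power: "of_padic_int (x ^ n) = of_padic_int x ^ n"
  by (induction n) (simp_all add: of_padic_int_1 of_padic_int_mult)

lemma of_padic_int_of_nat: "of_padic_int (of_nat n) = of_nat n"
  by (induction n) (simp_all add: of_padic_int_0 of_padic_int_1 of_padic_int_add)

lemma of_padic_int_sum: "of_padic_int (sum f S) = (\<Sum>i\<in>S. of_padic_int (f i))"
  by (induction S rule: infinite_finite_induct) (simp_all add: of_padic_int_0 of_padic_int_add)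

lemma to_ac_padic_cases:
  obtains a b :: "'p::prime_card padic_int" where "b \<noteq> 0" "to_ac x = of_padic_int a / of_padic_int b"
proof (cases x)
  case (Fract a b)
  then have "to_ac x = of_padic_int a / of_padic_int b"
    unfolding of_padic_int_def to_ac_divide[symmetric] by simp
  with Fract(2) that show ?thesis by blast
qed

lemma is_subring_padic_int: "is_subring (range of_padic_int)"
  unfolding is_subring_def
  by (auto simp flip: of_padic_int_1 of_padic_int_add of_padic_int_mult of_padic_int_minus)

lemma clear_denominators:
  assumes "finite S"
  shows "\<exists>d::'p::prime_card padic_int. d \<noteq> 0 \<and> (\<forall>x\<in>S. to_ac x * of_padic_int d \<in> range of_padic_int)"
  using assms
proof (induction S rule: finite_induct)
  case empty
  show ?case by (intro exI[of _ 1]) simp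
next
  case (insert x S)
  then obtain d where d: "d \<noteq> 0" "\<And>y. y \<in> S \<Longrightarrow> to_ac y * of_padic_int d \<in> range of_padic_int" by blast
  obtain a b where ab: "b \<noteq> 0" "to_ac x = of_padic_int a / of_padic_int b" by (rule to_ac_padic_cases)
  have "of_padic_int b \<noteq> 0" using ab(1) of_padic_int_eq_iff of_padic_int_0 by metis
  then have "to_ac x * of_padic_int (d * b) = of_padic_int (a * d)"
    using ab by (simp add: of_padic_int_mult)
  moreover have "to_ac y * of_padic_int (d * b) \<in> range of_padic_int" if y: "y \<in> S" for y
  proof -
    obtain e where "to_ac y * of_padic_int d = of_padic_int e" using d(2)[OF y] by blast
    then have "to_ac y * of_padic_int (d * b) = of_padic_int (e * b)"
      by (simp add: of_padic_int_mult mult.assoc[symmetric])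
    then show ?thesis by blast
  qed
  ultimately show ?case using d(1) ab(1) by (intro exI[of _ "d * b"]) auto
qed

text \<open>A relation over the \<open>p\<close>-adic numbers is multiplied by a common denominator
  of its coefficients.\<close>

lemma algebraic_over_padic_int:
  fixes x :: "'p::prime_card padic alg_closure"
  shows "\<exists>f. f \<noteq> 0 \<and> (\<forall>i. coeff f i \<in> range of_padic_int) \<and> poly f x = 0"
proof -
  obtain f where f: "f \<noteq> 0" "poly (map_poly to_ac f) x = 0"
    using alg_closure_algebraic[of x] .
  obtain d where d: "d \<noteq> 0" "\<forall>c\<in>range (coeff f). to_ac c * of_padic_int d \<in> range of_padic_int"
    using clear_denominators[of "range (coeff f)"] by (auto simp: range_coeff)
  have d0: "of_padic_int d \<noteq> 0" using d(1) of_padic_int_eq_iff of_padic_int_0 by metis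
  let ?g = "smult (of_padic_int d) (map_poly to_ac f)"
  have "map_poly to_ac f \<noteq> 0" using f(1) by (subst map_poly_eq_0_iff) auto
  then have "?g \<noteq> 0" using d0 by simp
  moreover have "coeff ?g i \<in> range of_padic_int" for i
    using d(2) by (simp add: coeff_map_poly mult.commute)
  moreover have "poly ?g x = 0" using f(2) by simp
  ultimately show ?thesis by blast
qed

section \<open>The curve\<close>

text \<open>Zorn's lemma applies to the \<open>p\<close>-adic integers with \<open>q = p\<close>,
  because \<open>1 / p\<close> is not among them.\<close>

lemma exists_padic_valuation_ring:
  obtains A :: "'p::prime_card padic alg_closure set"
  where "valued_extension A CARD('p) (range of_padic_int)"
proof -
  let ?Z = "range of_padic_int :: 'p padic alg_closure set" and ?P = "of_nat CARD('p) :: 'p padic alg_closure"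
  have P: "?P = of_padic_int (of_nat CARD('p))" by (simp add: of_padic_int_of_nat)
  have inverse_P: "inverse ?P \<notin> ?Z"
  proof
    assume "inverse ?P \<in> ?Z"
    then obtain z where z: "inverse ?P = of_padic_int z" by blast
    have "of_nat CARD('p) \<noteq> (0 :: 'p padic_int)"
    proof
      assume "of_nat CARD('p) = (0 :: 'p padic_int)"
      \<comment> \<open>Level \<open>2\<close> is the first at which the residue of \<open>p\<close>
        is not \<open>0\<close>.\<close>
      then have "int CARD('p) mod int CARD('p) ^ 2 = 0"
        using Rep_padic_int_of_nat[where 'p = 'p, of "CARD('p)" 2] by (simp add: zero_padic_int.rep_eq)
      then have "int CARD('p) * int CARD('p) dvd int CARD('p) * 1"
        by (simp add: power2_eq_square mod_eq_0_iff_dvd)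
      then show False
        using prime_gt_1_nat[OF prime_card[where 'a = 'p]] by (subst (asm) dvd_mult_cancel_left) auto
    qed
    then have "?P \<noteq> 0" unfolding P using of_padic_int_eq_iff of_padic_int_0 by metis
    then have "of_padic_int (of_nat CARD('p) * z) = of_padic_int 1"
      unfolding of_padic_int_mult of_padic_int_1 P[symmetric] z[symmetric] by simp
    then show False using padic_int_prime_not_unit of_padic_int_eq_iff by blast
  qed
  obtain A where A: "is_subring A" "?Z \<subseteq> A" "inverse ?P \<notin> A" "\<And>x. x \<in> A \<or> inverse x \<in> A"
    using exists_valuation_ring[OF is_subring_padic_int _ inverse_P] P by (metis rangeI)
  have "valued_extension A CARD('p) ?Z"
  proof
    fix z assume "z \<in> ?Z" "z \<noteq> 0"
    then obtain y where y: "z = of_padic_int y" "y \<noteq> 0" using of_padic_int_0 by auto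
    obtain k u w where kuw: "y = of_nat CARD('p) ^ k * u" "u * w = 1"
      using padic_int_factorization[OF y(2)] by blast
    have "of_padic_int u * of_padic_int w = 1"
      using kuw(2) by (metis of_padic_int_1 of_padic_int_mult)
    then have "inverse (of_padic_int u) = of_padic_int w" by (rule inverse_unique)
    moreover have "z = ?P ^ k * of_padic_int u"
      unfolding y kuw by (simp add: of_padic_int_mult of_padic_int_power of_padic_int_of_nat)
    ultimately show "\<exists>k u. z = ?P ^ k * u \<and> u \<in> ?Z \<and> inverse u \<in> ?Z"
      by (metis rangeI)
  next
    fix z assume "z \<in> ?Z"
    then obtain x where x: "z = of_padic_int x" by blast
    obtain y where "x ^ CARD('p) - x = of_nat CARD('p) * y"
      using padic_int_residue_field[of x] by (auto elim: dvdE)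
    then have "z ^ CARD('p) - z = ?P * of_padic_int y"
      unfolding x by (metis of_padic_int_diff of_padic_int_mult of_padic_int_of_nat of_padic_int_power)
    then show "\<exists>y\<in>?Z. z ^ CARD('p) - z = ?P * y" by blast
  next
    fix a :: "nat \<Rightarrow> 'p padic alg_closure" assume "\<And>k. a k \<in> ?Z"
    then have "\<forall>k. \<exists>b. a k = of_padic_int b" by blast
    then obtain b where b: "\<And>k. a k = of_padic_int (b k)" by metis
    obtain s where s: "\<And>N. of_nat CARD('p) ^ N dvd s - (\<Sum>k<N. of_nat CARD('p) ^ k * b k)"
      using padic_int_complete[of b] by blast
    have "\<exists>t\<in>?Z. of_padic_int s - (\<Sum>k<N. ?P ^ k * a k) = ?P ^ N * t" for N
    proof -
      obtain t where t: "s - (\<Sum>k<N. of_nat CARD('p) ^ k * b k) = of_nat CARD('p) ^ N * t"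
        using s[of N] by (auto elim: dvdE)
      have "of_padic_int s - (\<Sum>k<N. ?P ^ k * a k) = of_padic_int (s - (\<Sum>k<N. of_nat CARD('p) ^ k * b k))"
        by (simp add: b of_padic_int_diff of_padic_int_sum of_padic_int_mult of_padic_int_power of_padic_int_of_nat)
      also have "\<dots> = ?P ^ N * of_padic_int t"
        unfolding t by (simp add: of_padic_int_mult of_padic_int_power of_padic_int_of_nat)
      finally show ?thesis by blast
    qed
    then show "\<exists>s\<in>?Z. \<forall>N. \<exists>t\<in>?Z. s - (\<Sum>k<N. ?P ^ k * a k) = ?P ^ N * t" by blast
  qed (use A is_subring_padic_int algebraic_over_padic_int prime_card in blast)+
  then show ?thesis using that by blast
qed

section \<open>Galois groups of intermediate fields\<close>

lemma restrict_id_galois_group: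
  "restrict (\<lambda>x. x) F \<in> galois_group F" if "intermediate_field F"
  using that unfolding galois_group_def intermediate_field_def
  by (auto simp: bij_betw_def inj_on_def)

text \<open>\<open>compose F\<close> keeps the composite extensional, as membership in
  \<open>galois_group F\<close> requires.\<close>

lemma compose_galois_group:
  assumes F: "intermediate_field F" and \<sigma>: "\<sigma> \<in> galois_group F" and \<tau>: "\<tau> \<in> galois_group F"
  shows "compose F \<sigma> \<tau> \<in> galois_group F"
proof -
  have bij: "bij_betw \<sigma> F F" "bij_betw \<tau> F F" using \<sigma> \<tau> by (auto simp: galois_group_def)
  have cl: "\<tau> x \<in> F" if "x \<in> F" for x using bij(2) that by (auto simp: bij_betw_def)
  have "bij_betw (compose F \<sigma> \<tau>) F F" by (rule bij_betw_compose[OF bij(2,1)])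
  moreover have "x + y \<in> F" "x * y \<in> F" if "x \<in> F" "y \<in> F" for x y
    using F that by (auto simp: intermediate_field_def)
  moreover have "to_ac k \<in> F" for k using F by (auto simp: intermediate_field_def)
  ultimately show ?thesis
    using \<sigma> \<tau> cl by (simp add: galois_group_def compose_eq)
qed

lemma galois_valued_extension_padic:
  fixes F :: "'p::prime_card padic alg_closure set"
  assumes A: "valued_extension A CARD('p) (range of_padic_int)" and F: "abelian_extension F"
  shows "galois_valued_extension A CARD('p) (range of_padic_int) F (galois_group F)"
proof -
  interpret valued_extension A "CARD('p)" "range of_padic_int" by (rule A)
  have int: "intermediate_field F"
    and fixed: "{x \<in> F. \<forall>\<sigma>\<in>galois_group F. \<sigma> x = x} = range to_ac"
    and comm: "\<And>\<sigma> \<tau> x. \<sigma> \<in> galois_group F \<Longrightarrow> \<tau> \<in> galois_group F \<Longrightarrow> x \<in> F \<Longrightarrow> \<sigma> (\<tau> x) = \<tau> (\<sigma> x)"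
    using F unfolding abelian_extension_def galois_extension_def by auto
  have K: "range to_ac \<subseteq> F" using int by (simp add: intermediate_field_def)
  show ?thesis
  proof
    have "1 \<in> F" using K by (metis range_subsetD to_ac_1)
    then show "is_subring F" using int by (simp add: intermediate_field_def is_subring_def)
    show "range of_padic_int \<subseteq> F" using K by (auto simp: of_padic_int_def)
    show "inverse x \<in> F" if "x \<in> F" for x using int that by (simp add: intermediate_field_def)
    show "\<exists>\<rho>\<in>galois_group F. \<forall>x\<in>F. \<rho> x = x"
      using restrict_id_galois_group[OF int] by (rule bexI[rotated]) simp
    show "\<exists>a\<in>range of_padic_int. \<exists>b\<in>range of_padic_int. b \<noteq> 0 \<and> x = a / b"
      if x: "x \<in> F" "\<And>\<sigma>. \<sigma> \<in> galois_group F \<Longrightarrow> \<sigma> x = x" for x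
    proof -
      obtain k where k: "x = to_ac k" using fixed x by blast
      obtain a b :: "'p padic_int" where "b \<noteq> 0" "to_ac k = of_padic_int a / of_padic_int b"
        by (rule to_ac_padic_cases)
      then show ?thesis using k of_padic_int_eq_iff of_padic_int_0 by (metis rangeI)
    qed
    fix \<sigma> assume \<sigma>: "\<sigma> \<in> galois_group F"
    then show "\<sigma> x \<in> F" if "x \<in> F" for x
      using that by (auto simp: galois_group_def bij_betw_def)
    show "\<sigma> (x + y) = \<sigma> x + \<sigma> y" "\<sigma> (x * y) = \<sigma> x * \<sigma> y" if "x \<in> F" "y \<in> F" for x y
      using \<sigma> that by (auto simp: galois_group_def)
    show "\<sigma> z = z" if "z \<in> range of_padic_int" for z
      using \<sigma> that by (auto simp: galois_group_def of_padic_int_def)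
    fix \<tau> assume \<tau>: "\<tau> \<in> galois_group F"
    show "\<sigma> (\<tau> x) = \<tau> (\<sigma> x)" if "x \<in> F" for x by (rule comm[OF \<sigma> \<tau> that])
    show "\<exists>\<rho>\<in>galois_group F. \<forall>x\<in>F. \<rho> x = \<sigma> (\<tau> x)"
      using compose_galois_group[OF int \<sigma> \<tau>] by (rule bexI[rotated]) (simp add: compose_eq)
  qed
qed

text \<open>A class contains its own representative, by scaling with \<open>1 \<in> F\<close>, so
  the equation holds there.\<close>

lemma curve_point_representative:
  assumes Q: "Q \<in> curve_points F f" and F: "1 \<in> F"
  obtains x y z where "x \<in> F" "y \<in> F" "z \<in> F" "(x, y, z) \<noteq> (0, 0, 0)" "f x y z = 0"
proof -
  obtain x y z where xyz: "(x, y, z) \<in> homogeneous_coords F" "Q = proportional F `` {(x, y, z)}"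
    using Q by (auto simp: curve_points_def proj_plane_def elim!: quotientE)
  have "((x, y, z), (x, y, z)) \<in> proportional F"
    unfolding proportional_def using xyz(1) F by (auto intro!: bexI[of _ 1])
  then have "(x, y, z) \<in> Q" using xyz(2) by blast
  then have "f x y z = 0" using Q by (auto simp: curve_points_def)
  with xyz(1) that show ?thesis by (auto simp: homogeneous_coords_def)
qed

theorem theorem1:
  fixes a b c :: int and p :: nat
  assumes "p = CARD('p :: prime_card)"
    and "[int p = - 1] (mod 3)"
    and "coprime a (int p)" and "coprime b (int p)" and "coprime c (int p)"
  shows "curve_points (max_abelian_extension :: 'p padic alg_closure set)
           (\<lambda>x y z. of_int a * x ^ 3 + of_int b * of_nat p * y ^ 3 + of_int c * of_nat p ^ 2 * z ^ 3)
         = {}"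
proof (rule ccontr)
  let ?F = "max_abelian_extension :: 'p padic alg_closure set"
  assume "\<not> ?thesis"
  then obtain Q where Q: "Q \<in> curve_points ?F
    (\<lambda>x y z. of_int a * x ^ 3 + of_int b * of_nat p * y ^ 3 + of_int c * of_nat p ^ 2 * z ^ 3)" by blast
  have "1 \<in> ?F" using range_to_ac_subset by (metis range_subsetD to_ac_1)
  with Q obtain x y z where xyz: "x \<in> ?F" "y \<in> ?F" "z \<in> ?F" "(x, y, z) \<noteq> (0, 0, 0)"
    and eq: "of_int a * x ^ 3 + of_int b * of_nat p * y ^ 3 + of_int c * of_nat p ^ 2 * z ^ 3 = 0"
    by (rule curve_point_representative)
  obtain A :: "'p padic alg_closure set" where val: "valued_extension A CARD('p) (range of_padic_int)"
    by (rule exists_padic_valuation_ring)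
  interpret valued_extension A p "range of_padic_int" using val assms(1) by simp
  have p: "p = 3 * (p div 3) + 2"
    using assms(2) unfolding cong_def by presburger
  then have denominator: "\<exists>n::nat. \<not> 3 dvd n \<and> of_nat n * v t \<in> \<int>" if t: "t \<in> ?F" "t \<noteq> 0" for t
  proof -
    \<comment> \<open>The coordinates may lie in different abelian extensions. As \<open>A\<close>,
      and with it \<open>v\<close>, lives on the whole algebraic closure, each coordinate is treated
      in its own \<open>F\<close>.\<close>
    obtain F where Ft: "abelian_extension F" "t \<in> F" using t(1) by (auto simp: max_abelian_extension_def)
    interpret galois_valued_extension A p "range of_padic_int" F "galois_group F"
      using galois_valued_extension_padic[OF val Ft(1)] assms(1) by simp
    show ?thesis by (rule v_denominator[OF p Ft(2) t(2)])
  qed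
  \<comment> \<open>Coefficients and coordinates are indexed so that the \<open>i\<close>-th term
    carries the factor \<open>P ^ i\<close>.\<close>
  define \<alpha> where "\<alpha> = (\<lambda>i::nat. of_int ([a, b, c] ! i) :: 'p padic alg_closure)"
  define w where "w = (\<lambda>i::nat. [x, y, z] ! i)"
  have less_3: "i < 3 \<Longrightarrow> i = 0 \<or> i = 1 \<or> i = 2" for i :: nat by auto
  have "w i = 0" if "i < 3" for i
  proof (rule diagonal_cubic_no_zero[OF _ _ _ that, of \<alpha>])
    show "\<alpha> i \<in> U" if "i < 3" for i
      using less_3[OF that] assms(3-5) by (auto simp: \<alpha>_def intro!: of_int_U)
    show "\<exists>n::nat. \<not> 3 dvd n \<and> of_nat n * v (w i) \<in> \<int>" if "i < 3" "w i \<noteq> 0" for i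
      using less_3[OF that(1)] that(2) xyz(1-3) by (intro denominator) (auto simp: w_def)
    show "(\<Sum>i<3. \<alpha> i * P ^ i * w i ^ 3) = 0"
      using eq by (simp add: \<alpha>_def w_def numeral_3_eq_3 power2_eq_square)
  qed
  from this[of 0] this[of 1] this[of 2] show False using xyz(4) by (simp add: w_def)
qed

end
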